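(* Let $m,n\ge 1$ be integers, let $\mathbb{A}=(A_1,\dots,A_n),\ \mathbb{B}=(B_1,\dots,B_n)\in\mathbb{P}_m^n$, and let $\omega=(w_1,\dots,w_n),\ \mu=(\mu_1,\dots,\mu_n)\in\Delta_n$. Let $0<\alpha\le z<1$ with $z\ge\frac12$. Then $$\mathcal{R}_{\alpha,z}(\omega;\mathbb{A})^{\frac{1-\alpha}{z}}\circ\mathcal{R}_{\alpha,z}(\mu;\mathbb{B})^{\frac{1-\alpha}{z}}\le\sum_{i=1}^n\sum_{j=1}^n w_i\mu_j\left(A_i^{\frac{1-\alpha}{z}}\circ B_j^{\frac{1-\alpha}{z}}\right).$$
   Context: $\mathbb{P}_m$ is the set of $m\times m$ complex positive definite Hermitian matrices. $\Delta_n$ is the set of positive probability vectors $\omega=(w_1,\dots,w_n)$, i.e. $w_j>0$ for all $j$ and $\sum_j w_j=1$. $A\le B$ means $B-A$ is positive semidefinite. $A\circ B=[a_{ij}b_{ij}]$ is the Hadamard (entrywise) product. For $0<\alpha\le z<1$ and $A,B\in\mathbb{P}_m$, the $\alpha$-$z$ Bures-Wasserstein quantum divergence is $$\Phi_{\alpha,z}(A,B)=\operatorname{tr}((1-\alpha)A+\alpha B)-\operatorname{tr}\left(A^{\frac{1-\alpha}{2z}}B^{\frac{\alpha}{z}}A^{\frac{1-\alpha}{2z}}\right)^z.$$ The $\alpha$-$z$ weighted right mean $\mathcal{R}_{\alpha,z}(\omega;\mathbb{A})$ is the unique minimizer (which exists) over $X\in\mathbb{P}_m$ of $X\mapsto\sum_{j=1}^n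 w_j\Phi_{\alpha,z}(A_j,X)$. *)

theory Defs
  imports "HOL-Analysis.Analysis"
begin

definition adj :: "complex^'m^'m \<Rightarrow> complex^'m^'m" where
  "adj A = (\<chi> i j. cnj (A $ j $ i))"

definition hermitian :: "complex^'m^'m \<Rightarrow> bool" where
  "hermitian A \<longleftrightarrow> adj A = A"

definition unitary :: "complex^'m^'m \<Rightarrow> bool" where
  "unitary U \<longleftrightarrow> adj U ** U = mat 1 \<and> U ** adj U = mat 1"

(* The form v* A v.  It is real for Hermitian A, so the real part in the next
   definitions loses nothing. *)
definition quad_form :: "complex^'m^'m \<Rightarrow> complex^'m \<Rightarrow> complex" where
  "quad_form A v = (\<Sum>i\<in>UNIV. cnj (v $ i) * (A *v v) $ i)"

definition psd :: "complex^'m^'m \<Rightarrow> bool" where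
  "psd A \<longleftrightarrow> hermitian A \<and> (\<forall>v. 0 \<le> Re (quad_form A v))"

definition pos_def :: "(complex^'m^'m) set" where
  "pos_def = {A. hermitian A \<and> (\<forall>v. v \<noteq> 0 \<longrightarrow> 0 < Re (quad_form A v))}"

(* The library order on complex^'m^'m is the entrywise one, hence a separate symbol. *)
definition loewner_le :: "complex^'m^'m \<Rightarrow> complex^'m^'m \<Rightarrow> bool"  (infix "\<preceq>\<^sub>L" 50) where
  "A \<preceq>\<^sub>L B \<longleftrightarrow> psd (B - A)"

definition hadamard :: "complex^'m^'m \<Rightarrow> complex^'m^'m \<Rightarrow> complex^'m^'m"  (infixl "\<circ>\<^sub>H" 70) where
  "A \<circ>\<^sub>H B = (\<chi> i j. A $ i $ j * B $ i $ j)"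

definition real_diag :: "('m \<Rightarrow> real) \<Rightarrow> complex^'m^'m" where
  "real_diag d = (\<chi> i j. if i = j then of_real (d i) else 0)"

(* Real powers by functional calculus: if A = U diag(d) U* with U unitary, then
   A^r = U diag(d^r) U*, which does not depend on the choice of U and d.
   Used below for positive definite A only. *)
definition mat_powr :: "complex^'m^'m \<Rightarrow> real \<Rightarrow> complex^'m^'m"  (infixr "powr\<^sub>M" 80) where
  "A powr\<^sub>M r = (THE X. \<exists>U d. unitary U \<and> A = U ** real_diag d ** adj U \<and>
                          X = U ** real_diag (\<lambda>i. d i powr r) ** adj U)"

definition pos_prob_vecs :: "nat \<Rightarrow> (nat \<Rightarrow> real) set" where
  "pos_prob_vecs n = {w. (\<forall>j\<in>{1..n}. 0 < w j) \<and> (\<Sum>j=1..n. w j) = 1}"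

(* Both traces are real for positive definite A and B. *)
definition bw_divergence :: "real \<Rightarrow> real \<Rightarrow> complex^'m^'m \<Rightarrow> complex^'m^'m \<Rightarrow> real" where
  "bw_divergence \<alpha> z A B =
     Re (trace ((1 - \<alpha>) *\<^sub>R A + \<alpha> *\<^sub>R B))
     - Re (trace ((A powr\<^sub>M ((1 - \<alpha>) / (2 * z)) ** B powr\<^sub>M (\<alpha> / z)
                    ** A powr\<^sub>M ((1 - \<alpha>) / (2 * z))) powr\<^sub>M z))"

(* For 0 < alpha <= z < 1, w in pos_prob_vecs n and A_1, ..., A_n positive definite, the
   minimizer exists and is unique, so the choice made by arg_min_on is immaterial. *)
definition right_mean ::
  "real \<Rightarrow> real \<Rightarrow> nat \<Rightarrow> (nat \<Rightarrow> real) \<Rightarrow> (nat \<Rightarrow> complex^'m^'m) \<Rightarrow> complex^'m^'m" where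
  "right_mean \<alpha> z n w A =
     arg_min_on (\<lambda>X. \<Sum>j=1..n. w j * bw_divergence \<alpha> z (A j) X) pos_def"

end

theory Submission
  imports Defs
begin

text \<open>The right mean \<open>X\<close> solves \<open>X = \<Sum>j. w\<^sub>j Z\<^sub>j\<^bsup>z\<^esup>\<close> with
  \<open>Z\<^sub>j = X\<^bsup>\<alpha>/2z\<^esup> A\<^sub>j\<^bsup>p\<^esup> X\<^bsup>\<alpha>/2z\<^esup>\<close> and \<open>p = (1-\<alpha>)/z\<close>: the right-hand side maps a compact order
  interval into itself, so Brouwer's theorem gives a solution, and Klein's trace inequality shows
  that every solution is the strict global minimizer, without differentiating any matrix function.
  Since \<open>1 \<le> 1/z \<le> 2\<close>, the power \<open>1/z\<close> is operator convex, so
  \<open>X\<^bsup>1/z\<^esup> \<le> \<Sum>j. w\<^sub>j Z\<^sub>j\<close>. Congruence with \<open>X\<^bsup>-\<alpha>/2z\<^esup>\<close> turns this into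
  \<open>X\<^bsup>p\<^esup> \<le> \<Sum>j. w\<^sub>j A\<^sub>j\<^bsup>p\<^esup>\<close>, and the Schur product theorem makes the Hadamard product monotone.\<close>

section \<open>The spectral theorem\<close>

text \<open>The minimizer is not found by compactness and then differentiated; the stationarity
  equation is solved before anything is minimized. The obstacle is that the objective is not visibly
  convex in X. In the variable Y = X^(\<alpha>/z), and with C_j = A_j^((1-\<alpha>)/2z), its
  non-constant part is \<alpha> tr Y^(z/\<alpha>), convex because \<alpha> \<le> z, minus the
  weighted traces tr (C_j Y C_j)^z, strictly concave because z < 1. Stationarity in Y reads
  Y^(z/\<alpha> - 1) = sum over j of w_j C_j (C_j Y C_j)^(z-1) C_j, and congruence with Y^(1/2) is
  what produces the equation for X. Matrix functions are handled throughout by explicit spectral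
  data, a unitary \<open>U\<close> and a real diagonal \<open>d\<close>, so that each matrix
  statement comes down to one about real numbers.\<close>

definition cip :: "complex^'m \<Rightarrow> complex^'m \<Rightarrow> complex" where
  "cip x y = (\<Sum>i\<in>UNIV. cnj (x $ i) * y $ i)"

lemma quad_form_cip: "quad_form A v = cip v (A *v v)"
  by (simp add: quad_form_def cip_def)

lemma cip_simps [simp]:
  "cip 0 y = 0" "cip x 0 = 0"
  "cip (x + y) v = cip x v + cip y v" "cip v (x + y) = cip v x + cip v y"
  "cip (x - y) v = cip x v - cip y v" "cip v (x - y) = cip v x - cip v y"
  "cip (r *\<^sub>R x) v = of_real r * cip x v" "cip v (r *\<^sub>R x) = of_real r * cip v x"
  "cip (c *s x) v = cnj c * cip x v" "cip v (c *s x) = c * cip v x"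
  "cip (- x) v = - cip x v" "cip v (- x) = - cip v x"
  unfolding cip_def
  by (simp_all add: sum.distrib sum_subtractf sum_distrib_left algebra_simps sum_negf
      scaleR_conv_of_real[where 'a=complex])

lemma cip_sum_right: "cip v (\<Sum>i\<in>I. f i) = (\<Sum>i\<in>I. cip v (f i))"
  by (induction I rule: infinite_finite_induct) auto

lemma cnj_cip: "cnj (cip x y) = cip y x"
  by (simp add: cip_def mult.commute)

lemma cip_self: "cip x x = of_real ((norm x)\<^sup>2)"
proof -
  have "(norm x)\<^sup>2 = (\<Sum>i\<in>UNIV. (norm (x $ i))\<^sup>2)"
    by (simp add: norm_vec_def L2_set_def sum_nonneg)
  thus ?thesis
    by (simp add: cip_def complex_norm_square mult.commute del: of_real_power)
qed

lemma cip_adj: "cip x (A *v y) = cip (adj A *v x) y"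
proof -
  have "cip x (A *v y) = (\<Sum>i\<in>UNIV. \<Sum>j\<in>UNIV. cnj (x $ i) * (A $ i $ j * y $ j))"
    by (simp add: cip_def matrix_vector_mult_def sum_distrib_left)
  also have "\<dots> = (\<Sum>j\<in>UNIV. \<Sum>i\<in>UNIV. cnj (x $ i) * (A $ i $ j * y $ j))"
    by (rule sum.swap)
  also have "\<dots> = cip (adj A *v x) y"
    by (simp add: cip_def matrix_vector_mult_def sum_distrib_left adj_def mult_ac)
  finally show ?thesis .
qed

lemma adj_adj [simp]: "adj (adj A) = A"
  by (simp add: adj_def vec_eq_iff)

lemma adj_mult: "adj (A ** B) = adj B ** adj A"
  by (simp add: adj_def vec_eq_iff matrix_matrix_mult_def mult.commute)

lemma adj_simps [simp]:
  "adj (A + B) = adj A + adj B" "adj (A - B) = adj A - adj B" "adj (r *\<^sub>R A) = r *\<^sub>R adj A"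
  "adj (0 :: complex^'m^'m) = 0" "adj (mat 1 :: complex^'m^'m) = mat 1"
  "adj (real_diag d) = real_diag d"
  by (simp_all add: adj_def vec_eq_iff mat_def real_diag_def)

lemma adj_sum: "adj (\<Sum>i\<in>I. f i) = (\<Sum>i\<in>I. adj (f i))"
  by (induction I rule: infinite_finite_induct) auto

lemma mat_vec_scaleR: "A *v (c *\<^sub>R x) = c *\<^sub>R (A *v x)" for A :: "complex^'m^'m"
  by (simp add: vec_eq_iff matrix_vector_mult_def scaleR_sum_right)

lemma continuous_on_cip [continuous_intros]:
  assumes "continuous_on S f" "continuous_on S g"
  shows "continuous_on S (\<lambda>x. cip (f x) (g x))"
  unfolding cip_def by (intro continuous_intros assms)

lemma continuous_on_mat_vec [continuous_intros]:
  fixes A :: "'a::topological_space \<Rightarrow> complex^'m^'m"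
  assumes "continuous_on S A" "continuous_on S f"
  shows "continuous_on S (\<lambda>x. A x *v f x)"
  unfolding matrix_vector_mult_def by (intro continuous_intros assms continuous_on_vec_lambda)

lemma continuous_on_mat_mult [continuous_intros]:
  fixes A :: "'a::topological_space \<Rightarrow> complex^'m^'m"
  assumes "continuous_on S A" "continuous_on S B"
  shows "continuous_on S (\<lambda>x. A x ** B x)"
  unfolding matrix_matrix_mult_def by (intro continuous_intros assms continuous_on_vec_lambda)

text \<open>The first-order condition at a maximum, in place of a derivative: for small t with the
  sign of a, the linear term would outweigh the quadratic one.\<close>

lemma linear_coeff_zero:
  fixes a b :: real
  assumes "\<And>t. t * a + t\<^sup>2 * b \<le> 0"
  shows "a = 0"
proof (rule ccontr)
  assume a: "a \<noteq> 0"
  define t where "t = a / (\<bar>b\<bar> + 1)"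
  have "\<bar>b\<bar> + 1 \<noteq> 0" by linarith
  hence "a = t * (\<bar>b\<bar> + 1)" by (simp add: t_def)
  hence "t * a + t\<^sup>2 * b = t\<^sup>2 * (\<bar>b\<bar> + 1 + b)"
    by (simp add: algebra_simps power2_eq_square)
  moreover have "t\<^sup>2 * (\<bar>b\<bar> + 1 + b) > 0"
    using a by (intro mult_pos_pos) (auto simp: t_def)
  ultimately show False using assms[of t] by linarith
qed

text \<open>The orthogonal complement \<open>T\<close> of the eigenvectors found so far is invariant
  under A, so the form of A attains its maximum on the unit sphere of \<open>T\<close>, and a
  maximizer is an eigenvector.\<close>

lemma hermitian_extend_eigenvectors:
  fixes A :: "complex^'m^'m"
  assumes A: "hermitian A"
    and S: "finite S" "card S < CARD('m)"
    and ortho: "\<And>u v. u \<in> S \<Longrightarrow> v \<in> S \<Longrightarrow> cip u v = (if u = v then 1 else 0)"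
    and eig: "\<And>u. u \<in> S \<Longrightarrow> \<exists>l. A *v u = l *\<^sub>R u"
  shows "\<exists>v l. cip v v = 1 \<and> (\<forall>u\<in>S. cip u v = 0) \<and> A *v v = l *\<^sub>R v"
proof -
  define T where "T = {v. \<forall>u\<in>S. cip u v = 0}"
  have T_add: "x + y \<in> T" "r *\<^sub>R x \<in> T" if "x \<in> T" "y \<in> T" for x y r
    using that by (auto simp: T_def)
  have AT: "A *v x \<in> T" if "x \<in> T" for x
    unfolding T_def
  proof clarify
    fix u assume u: "u \<in> S"
    obtain l where l: "A *v u = l *\<^sub>R u" using eig u by blast
    have "cip u (A *v x) = cip (A *v u) x"
      using A by (simp add: cip_adj hermitian_def)
    thus "cip u (A *v x) = 0" using that u l by (simp add: T_def)
  qed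
  have "vec.dim (vec.span S) \<le> card S"
    using S by (intro vec.dim_le_card) auto
  hence "vec.span S \<noteq> UNIV"
    using S vec_dim_card[where 'a=complex and 'n='m]
    by (metis linorder_not_le vec.dim_span)
  then obtain x where x: "x \<notin> vec.span S" by blast
  define y where "y = x - (\<Sum>u\<in>S. cip u x *s u)"
  have "(\<Sum>u\<in>S. cip u x *s u) \<in> vec.span S"
    by (intro vec.span_sum vec.span_scale vec.span_base)
  with x have y0: "y \<noteq> 0" by (auto simp: y_def)
  have yT: "y \<in> T"
    unfolding T_def
  proof clarify
    fix v assume v: "v \<in> S"
    have "cip v (\<Sum>u\<in>S. cip u x *s u) = (\<Sum>u\<in>S. if u = v then cip u x else 0)"
      unfolding cip_sum_right by (intro sum.cong) (auto simp: ortho v)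
    also have "\<dots> = cip v x" using v S by simp
    finally show "cip v y = 0" by (simp add: y_def)
  qed
  define K where "K = sphere 0 1 \<inter> T"
  have "closed T"
    unfolding T_def Collect_ball_eq
    by (intro closed_INT ballI closed_Collect_eq continuous_intros)
  hence K: "compact K" unfolding K_def by (intro compact_Int_closed) auto
  have Kne: "(1 / norm y) *\<^sub>R y \<in> K"
    using y0 T_add[OF yT yT] by (auto simp: K_def)
  obtain v where v: "v \<in> K"
    and vmax: "\<And>x. x \<in> K \<Longrightarrow> Re (cip x (A *v x)) \<le> Re (cip v (A *v v))"
  proof -
    have "continuous_on K (\<lambda>x. Re (cip x (A *v x)))"
      by (intro continuous_intros)
    with K Kne show thesis
      using continuous_attains_sup[of K "\<lambda>x. Re (cip x (A *v x))"] that by blast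
  qed
  have vT: "v \<in> T" and v1: "norm v = 1" using v by (auto simp: K_def)
  define l where "l = Re (cip v (A *v v))"
  have le: "Re (cip x (A *v x)) \<le> l * (norm x)\<^sup>2" if "x \<in> T" for x
  proof (cases "x = 0")
    case False
    have "(1 / norm x) *\<^sub>R x \<in> K" using False T_add[OF that that] by (auto simp: K_def)
    from vmax[OF this] show ?thesis
      using False by (simp add: l_def mat_vec_scaleR field_simps power2_eq_square)
  qed auto
  \<comment> \<open>The residual of the eigenvalue equation serves as the direction of perturbation.
    It stays in \<open>T\<close>, its inner product with v has real part 0 because l is the value of
    the form at v, and the linear coefficient in t becomes 2 |r|^2.\<close>
  define r where "r = A *v v - l *\<^sub>R v"
  have rT: "r \<in> T"
    using AT[OF vT] vT by (auto simp: r_def T_def)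
  have sym: "cip v (A *v r) = cip (A *v v) r"
    using A by (simp add: cip_adj hermitian_def)
  have "t * (2 * (norm r)\<^sup>2) + t\<^sup>2 * (Re (cip r (A *v r)) - l * (norm r)\<^sup>2) \<le> 0" for t
  proof -
    define w where "w = v + t *\<^sub>R r"
    have "w \<in> T" using T_add vT rT by (auto simp: w_def)
    have Av: "A *v v = r + l *\<^sub>R v" by (simp add: r_def)
    have rv: "Re (cip r v) = Re (cip v r)"
      by (metis cnj_cip cnj.sel(1))
    have lv: "Re (cip v r) = 0"
      using v1 by (simp add: r_def cip_self l_def)
    have 1: "Re (cip w (A *v w)) = l + t * (2 * (norm r)\<^sup>2) + t\<^sup>2 * Re (cip r (A *v r))"
      unfolding w_def
      by (simp add: matrix_vector_right_distrib mat_vec_scaleR sym)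
         (simp add: Av cip_self v1 rv lv algebra_simps power2_eq_square)
    have "cip w w = cip v v + t * cip v r + t * cip r v + t\<^sup>2 * cip r r"
      unfolding w_def by (simp only: cip_simps) (simp add: algebra_simps power2_eq_square)
    hence "Re (cip w w) = (norm v)\<^sup>2 + t * Re (cip v r) + t * Re (cip r v) + t\<^sup>2 * (norm r)\<^sup>2"
      by (simp add: cip_self flip: of_real_power)
    hence "(norm w)\<^sup>2 = 1 + t\<^sup>2 * (norm r)\<^sup>2"
      using rv lv v1 by (simp add: cip_self flip: of_real_power)
    thus ?thesis
      using le[OF \<open>w \<in> T\<close>] 1 by (simp add: algebra_simps)
  qed
  from linear_coeff_zero[OF this] have "r = 0" by simp
  hence "A *v v = l *\<^sub>R v" by (simp add: r_def)
  moreover have "cip v v = 1" using v1 by (simp add: cip_self)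
  ultimately show ?thesis using vT by (auto simp: T_def)
qed

lemma hermitian_orthonormal_eigenvectors:
  fixes A :: "complex^'m^'m"
  assumes "hermitian A" "k \<le> CARD('m)"
  shows "\<exists>S. finite S \<and> card S = k \<and>
           (\<forall>u\<in>S. \<forall>v\<in>S. cip u v = (if u = v then 1 else 0)) \<and> (\<forall>u\<in>S. \<exists>l. A *v u = l *\<^sub>R u)"
  using assms(2)
proof (induction k)
  case 0
  show ?case by (rule exI[of _ "{}"]) auto
next
  case (Suc k)
  obtain S where S: "finite S" "card S = k"
      "\<forall>u\<in>S. \<forall>v\<in>S. cip u v = (if u = v then 1 else 0)" "\<forall>u\<in>S. \<exists>l. A *v u = l *\<^sub>R u"
    using Suc.IH[OF Suc_leD[OF Suc.prems]] by blast
  have "card S < CARD('m)" using S(2) Suc.prems by simp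
  from hermitian_extend_eigenvectors[OF assms(1) S(1) this] S(3,4)
  obtain v l where v: "cip v v = 1" "\<forall>u\<in>S. cip u v = 0" "A *v v = l *\<^sub>R v"
    by blast
  have v': "cip v u = 0" if "u \<in> S" for u
    using v(2) that cnj_cip[of u v] by (metis complex_cnj_zero)
  have "v \<notin> S" using v(1,2) by fastforce
  have fin: "finite (insert v S)" "card (insert v S) = Suc k"
    using S \<open>v \<notin> S\<close> by auto
  have ortho: "cip x y = (if x = y then 1 else 0)" if "x \<in> insert v S" "y \<in> insert v S" for x y
  proof (cases "x = v \<or> y = v")
    case True
    with that v(1,2) v' \<open>v \<notin> S\<close> show ?thesis by (metis insertE)
  next
    case False
    with that S(3) show ?thesis by blast
  qed
  have eig: "\<exists>l. A *v x = l *\<^sub>R x" if "x \<in> insert v S" for x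
    using that S(4) v(3) by (metis insertE)
  show ?case
    by (intro exI[of _ "insert v S"] conjI ballI fin) (erule (1) ortho, erule eig)
qed

lemma real_diag_vec: "(real_diag d *v x) $ i = of_real (d i) * x $ i"
  by (simp add: real_diag_def matrix_vector_mult_def mult_delta_left)

lemma mult_real_diag: "(A ** real_diag d) $ i $ j = A $ i $ j * of_real (d j)"
  by (simp add: real_diag_def matrix_matrix_mult_def mult_delta_right)

lemma real_diag_mult: "(real_diag d ** A) $ i $ j = of_real (d i) * A $ i $ j"
  by (simp add: real_diag_def matrix_matrix_mult_def mult_delta_left)

lemma hermitian_spectral:
  fixes A :: "complex^'m^'m"
  assumes "hermitian A"
  obtains U d where "unitary U" "A = U ** real_diag d ** adj U"
proof -
  obtain S where S: "finite S" "card S = CARD('m)"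
      "\<forall>u\<in>S. \<forall>v\<in>S. cip u v = (if u = v then 1 else 0)" "\<forall>u\<in>S. \<exists>l. A *v u = l *\<^sub>R u"
    using hermitian_orthonormal_eigenvectors[OF assms order_refl] by auto
  obtain f where f: "bij_betw f (UNIV :: 'm set) S"
    using finite_same_card_bij[of "UNIV :: 'm set", OF finite S(1)] S(2) by force
  have fS: "f j \<in> S" for j using f by (auto simp: bij_betw_def)
  have f_inj: "f i = f j \<longleftrightarrow> i = j" for i j using f by (metis bij_betw_def inj_eq)
  have "\<forall>j. \<exists>l. A *v f j = l *\<^sub>R f j" using S(4) fS by blast
  then obtain d where d: "\<And>j. A *v f j = d j *\<^sub>R f j" by metis
  define U where "U = (\<chi> i j. f j $ i)"
  have "(adj U ** U) $ i $ j = cip (f i) (f j)" for i j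
    by (simp add: adj_def U_def matrix_matrix_mult_def cip_def)
  moreover have "cip (f i) (f j) = (if i = j then 1 else 0)" for i j
    using S(3) fS f_inj by metis
  ultimately have UU: "adj U ** U = mat 1"
    by (simp add: vec_eq_iff mat_def)
  hence U: "unitary U"
    by (simp add: unitary_def matrix_left_right_inverse)
  have "(A ** U) $ i $ j = (U ** real_diag d) $ i $ j" for i j
  proof -
    have "(A ** U) $ i $ j = (A *v f j) $ i"
      by (simp add: matrix_matrix_mult_def matrix_vector_mult_def U_def)
    also have "\<dots> = of_real (d j) * f j $ i"
      unfolding d by (simp add: scaleR_conv_of_real[where 'a=complex])
    finally show ?thesis by (simp add: mult_real_diag U_def)
  qed
  hence "A ** U = U ** real_diag d" by (simp add: vec_eq_iff)
  hence "A ** (U ** adj U) = U ** real_diag d ** adj U" by (simp add: matrix_mul_assoc)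
  hence "A = U ** real_diag d ** adj U" using U by (simp add: unitary_def)
  with U that show ?thesis by blast
qed

section \<open>Powers of positive definite matrices\<close>

definition spec :: "complex^'m^'m \<Rightarrow> ('m \<Rightarrow> real) \<Rightarrow> complex^'m^'m" where
  "spec U d = U ** real_diag d ** adj U"

lemma mat_scaleR_vec: "(c *\<^sub>R A) *v x = c *\<^sub>R (A *v x)" for A :: "complex^'m^'m"
  by (simp add: vec_eq_iff matrix_vector_mult_def scaleR_sum_right)

lemma unitary_cancel:
  assumes "unitary U"
  shows "adj U ** U = mat 1" "U ** adj U = mat 1"
    "X ** adj U ** U = X" "X ** U ** adj U = X"
  using assms by (auto simp: unitary_def simp flip: matrix_mul_assoc)

lemma unitary_mat_1 [simp]: "unitary (mat 1)"
  by (simp add: unitary_def)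

lemma hermitian_spec: "hermitian (spec U d)"
  by (simp add: hermitian_def spec_def adj_mult matrix_mul_assoc)

lemma spec_mult:
  assumes "unitary U"
  shows "spec U d ** spec U e = spec U (\<lambda>i. d i * e i)"
proof -
  have "real_diag d ** real_diag e = real_diag (\<lambda>i. d i * e i)"
    by (auto simp: vec_eq_iff real_diag_mult) (auto simp: real_diag_def)
  moreover have "spec U d ** spec U e = U ** (real_diag d ** real_diag e) ** adj U"
    by (simp add: spec_def matrix_mul_assoc unitary_cancel[OF assms])
  ultimately show ?thesis by (simp add: spec_def)
qed

lemma spec_1:
  fixes U :: "complex^'m^'m"
  assumes "unitary U"
  shows "spec U (\<lambda>i. 1) = mat 1"
proof -
  have "real_diag (\<lambda>i. 1) = (mat 1 :: complex^'m^'m)"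
    by (simp add: vec_eq_iff real_diag_def mat_def)
  thus ?thesis by (simp add: spec_def unitary_cancel[OF assms])
qed

text \<open>In eigenbases, T becomes a matrix W whose entry (i, j) vanishes unless d i = e j, so the
  relation passes to an arbitrary function f without polynomial approximation. With T = 1 it shows
  that powers do not depend on the diagonalization chosen.\<close>

lemma spec_intertwine:
  assumes U: "unitary U" and V: "unitary V"
    and eq: "spec U d ** T = T ** spec V e"
  shows "spec U (\<lambda>i. f (d i)) ** T = T ** spec V (\<lambda>i. f (e i))"
proof -
  define W where "W = adj U ** T ** V"
  have "real_diag d ** W = adj U ** (spec U d ** T) ** V"
    by (simp add: W_def spec_def matrix_mul_assoc unitary_cancel[OF U])
  also have "\<dots> = W ** real_diag e"
    unfolding eq by (simp add: W_def spec_def matrix_mul_assoc unitary_cancel[OF V])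
  finally have DW: "of_real (d i) * W $ i $ j = W $ i $ j * of_real (e j)" for i j
    by (metis real_diag_mult mult_real_diag)
  have "W $ i $ j = 0 \<or> d i = e j" for i j
    using DW[of i j] by (auto simp: mult.commute)
  hence "real_diag (\<lambda>i. f (d i)) ** W = W ** real_diag (\<lambda>i. f (e i))"
    unfolding vec_eq_iff real_diag_mult mult_real_diag by (metis mult.commute mult_zero_left)
  hence "U ** (real_diag (\<lambda>i. f (d i)) ** W) ** adj V = U ** (W ** real_diag (\<lambda>i. f (e i))) ** adj V"
    by simp
  thus ?thesis
    by (simp add: W_def spec_def matrix_mul_assoc unitary_cancel[OF U] unitary_cancel[OF V])
qed

lemma spec_powr:
  assumes "unitary U"
  shows "spec U d powr\<^sub>M r = spec U (\<lambda>i. d i powr r)"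
  unfolding mat_powr_def
proof (rule the_equality)
  show "\<exists>Ua da. unitary Ua \<and> spec U d = Ua ** real_diag da ** adj Ua \<and>
      spec U (\<lambda>i. d i powr r) = Ua ** real_diag (\<lambda>i. da i powr r) ** adj Ua"
    using assms by (auto simp: spec_def)
next
  fix X
  assume "\<exists>V e. unitary V \<and> spec U d = V ** real_diag e ** adj V \<and>
      X = V ** real_diag (\<lambda>i. e i powr r) ** adj V"
  then obtain V e where V: "unitary V" "spec U d = spec V e" "X = spec V (\<lambda>i. e i powr r)"
    by (auto simp: spec_def)
  show "X = spec U (\<lambda>i. d i powr r)"
    using spec_intertwine[OF assms V(1), of d "mat 1" e "\<lambda>x. x powr r"] V by simp
qed

lemma spec_cip: "cip v (spec U d *v v) = of_real (\<Sum>i\<in>UNIV. d i * (norm ((adj U *v v) $ i))\<^sup>2)"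
proof -
  have "cip v (spec U d *v v) = cip (adj U *v v) (real_diag d *v (adj U *v v))"
    by (simp add: spec_def cip_adj matrix_vector_mul_assoc[symmetric])
  also have "\<dots> = of_real (\<Sum>i\<in>UNIV. d i * (norm ((adj U *v v) $ i))\<^sup>2)"
    unfolding cip_def real_diag_vec of_real_sum of_real_mult complex_norm_square
    by (simp add: mult_ac)
  finally show ?thesis .
qed

lemma unitary_norm:
  assumes "unitary U"
  shows "(\<Sum>i\<in>UNIV. (norm ((adj U *v v) $ i))\<^sup>2) = (norm v)\<^sup>2"
  using spec_cip[of v U "\<lambda>i. 1"]
  unfolding spec_1[OF assms] by (simp add: cip_self flip: of_real_power of_real_sum)

text \<open>The matrices between the scalar matrices a and b. The description by forms makes
  convexity immediate, while the equivalent one by eigenvalues in [a, b] gives compactness and the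
  effect of powers.\<close>

definition loewner_interval :: "real \<Rightarrow> real \<Rightarrow> (complex^'m^'m) set" where
  "loewner_interval a b = {X. hermitian X \<and> (\<forall>v. a * (norm v)\<^sup>2 \<le> Re (cip v (X *v v)) \<and>
                                        Re (cip v (X *v v)) \<le> b * (norm v)\<^sup>2)}"

text \<open>The vector \<open>U *v axis i 1\<close> is the i-th column of U, a unit eigenvector;
  testing the form on it reads off \<open>d i\<close>.\<close>

lemma spec_column:
  fixes U :: "complex^'m^'m"
  assumes "unitary U"
  shows "Re (cip (U *v axis i 1) (spec U d *v (U *v axis i 1))) = d i"
    and "norm (U *v axis i 1) = 1"
proof -
  have *: "adj U *v (U *v axis i 1) = axis i 1"
    by (simp add: matrix_vector_mul_assoc unitary_cancel[OF assms])
  have "(norm ((axis i 1 :: complex^'m) $ j))\<^sup>2 = (if j = i then 1 else 0)" for j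
    by (auto simp: axis_def)
  note ** = * this
  show "Re (cip (U *v axis i 1) (spec U d *v (U *v axis i 1))) = d i"
    unfolding spec_cip ** by (simp add: mult_delta_right)
  have "(norm (U *v axis i 1))\<^sup>2 = 1"
    unfolding unitary_norm[OF assms, symmetric] ** by simp
  thus "norm (U *v axis i 1) = 1" using norm_ge_zero[of "U *v axis i 1"] unfolding power2_eq_1_iff by linarith
qed

lemma spec_in_loewner_interval:
  assumes "unitary U"
  shows "spec U d \<in> loewner_interval a b \<longleftrightarrow> (\<forall>i. a \<le> d i \<and> d i \<le> b)"
proof
  assume *: "spec U d \<in> loewner_interval a b"
  show "\<forall>i. a \<le> d i \<and> d i \<le> b"
  proof
    fix i
    let ?v = "U *v axis i 1"
    have "a * (norm ?v)\<^sup>2 \<le> Re (cip ?v (spec U d *v ?v))" "Re (cip ?v (spec U d *v ?v)) \<le> b * (norm ?v)\<^sup>2"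
      using * unfolding loewner_interval_def by blast+
    thus "a \<le> d i \<and> d i \<le> b" by (simp only: spec_column[OF assms]) simp
  qed
next
  assume *: "\<forall>i. a \<le> d i \<and> d i \<le> b"
  have "a * (norm v)\<^sup>2 \<le> Re (cip v (spec U d *v v))" "Re (cip v (spec U d *v v)) \<le> b * (norm v)\<^sup>2" for v
    unfolding spec_cip unitary_norm[OF assms, symmetric] sum_distrib_left Re_complex_of_real
    using * by (auto intro!: sum_mono mult_right_mono)
  thus "spec U d \<in> loewner_interval a b"
    by (simp add: loewner_interval_def hermitian_spec)
qed

lemma spec_pos_def:
  assumes "unitary U"
  shows "spec U d \<in> pos_def \<longleftrightarrow> (\<forall>i. 0 < d i)"
proof
  assume *: "spec U d \<in> pos_def"
  show "\<forall>i. 0 < d i"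
  proof
    fix i
    have "U *v axis i 1 \<noteq> 0" using spec_column(2)[OF assms, of i] by auto
    thus "0 < d i" using * spec_column(1)[OF assms, of i d]
      by (auto simp: pos_def_def quad_form_cip)
  qed
next
  assume *: "\<forall>i. 0 < d i"
  have "0 < Re (cip v (spec U d *v v))" if "v \<noteq> 0" for v
  proof -
    have "adj U *v v \<noteq> 0"
    proof
      assume "adj U *v v = 0"
      hence "(norm v)\<^sup>2 = 0" unfolding unitary_norm[OF assms, symmetric] by simp
      thus False using that by simp
    qed
    then obtain i where "(adj U *v v) $ i \<noteq> 0"
      by (auto simp: vec_eq_iff)
    hence "0 < d i * (norm ((adj U *v v) $ i))\<^sup>2" using * by simp
    moreover have "0 \<le> d j * (norm ((adj U *v v) $ j))\<^sup>2" for j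
      using * by (intro mult_nonneg_nonneg) (auto simp: less_imp_le)
    ultimately show ?thesis unfolding spec_cip Re_complex_of_real
      by (intro sum_pos2[of UNIV i]) simp_all
  qed
  thus "spec U d \<in> pos_def"
    by (simp add: pos_def_def hermitian_spec quad_form_cip)
qed

lemma pos_def_spectral:
  assumes "A \<in> pos_def"
  obtains U d where "unitary U" "\<And>i. 0 < d i" "A = spec U d"
proof -
  have "hermitian A" using assms by (simp add: pos_def_def)
  then obtain U d where U: "unitary U" "A = spec U d"
    by (auto elim: hermitian_spectral simp: spec_def)
  thus ?thesis using assms spec_pos_def[OF U(1), of d] that[of U d] by metis
qed

lemma pos_def_in_loewner_interval:
  assumes "A \<in> pos_def"
  obtains a b where "0 < a" "a \<le> b" "A \<in> loewner_interval a b"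
proof -
  obtain U d where U: "unitary U" "\<And>i. 0 < d i" "A = spec U d"
    by (rule pos_def_spectral[OF assms]) blast
  have fin: "finite (range d)" by simp
  have "0 < Min (range d)" using U(2) by (subst Min_gr_iff) auto
  moreover have "Min (range d) \<le> Max (range d)" by simp
  moreover have "A \<in> loewner_interval (Min (range d)) (Max (range d))"
    unfolding U(3) spec_in_loewner_interval[OF U(1)] by auto
  ultimately show ?thesis using that by blast
qed

lemma loewner_interval_pos_def:
  assumes "A \<in> loewner_interval a b" "0 < a"
  shows "A \<in> pos_def"
proof -
  have "hermitian A" using assms by (simp add: loewner_interval_def)
  then obtain U d where U: "unitary U" "A = spec U d"
    by (auto elim: hermitian_spectral simp: spec_def)
  thus ?thesis using assms spec_pos_def[OF U(1)] spec_in_loewner_interval[OF U(1)]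
    by (meson less_le_trans)
qed

lemma loewner_interval_mono: "A \<in> loewner_interval a b \<Longrightarrow> a' \<le> a \<Longrightarrow> b \<le> b' \<Longrightarrow> A \<in> loewner_interval a' b'"
  unfolding loewner_interval_def
  by (auto intro: order_trans[OF mult_right_mono] order_trans[OF _ mult_right_mono])

lemma loewner_interval_le: "(A :: complex^'m^'m) \<in> loewner_interval a b \<Longrightarrow> a \<le> b"
proof -
  assume A: "A \<in> loewner_interval a b"
  then have "hermitian A" by (simp add: loewner_interval_def)
  then obtain U d where U: "unitary U" "A = spec U d"
    by (auto elim: hermitian_spectral simp: spec_def)
  show ?thesis using A unfolding U spec_in_loewner_interval[OF U(1)] by (meson order_trans)
qed

section \<open>Laws of real powers and congruences\<close>

lemma powr_pos_def:
  assumes "A \<in> pos_def"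
  shows "A powr\<^sub>M r \<in> pos_def"
  using pos_def_spectral[OF assms] by (metis powr_gt_zero spec_pos_def spec_powr less_irrefl)

lemma pos_def_powr_add:
  assumes "A \<in> pos_def"
  shows "A powr\<^sub>M r ** A powr\<^sub>M s = A powr\<^sub>M (r + s)"
  by (rule pos_def_spectral[OF assms]) (simp add: spec_powr spec_mult powr_add)

lemma pos_def_powr_powr:
  assumes "A \<in> pos_def"
  shows "(A powr\<^sub>M r) powr\<^sub>M s = A powr\<^sub>M (r * s)"
  by (rule pos_def_spectral[OF assms]) (simp add: spec_powr powr_powr)

lemma pos_def_powr_0:
  assumes "A \<in> pos_def"
  shows "A powr\<^sub>M 0 = mat 1"
  by (rule pos_def_spectral[OF assms]) (auto simp: spec_powr less_imp_neq[symmetric] spec_1)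

lemma pos_def_powr_1:
  assumes "A \<in> pos_def"
  shows "A powr\<^sub>M 1 = A"
  by (rule pos_def_spectral[OF assms]) (auto simp: spec_powr less_imp_le)

lemma powr_in_loewner_interval:
  assumes "A \<in> loewner_interval a b" "0 < a" "0 \<le> r"
  shows "A powr\<^sub>M r \<in> loewner_interval (a powr r) (b powr r)"
proof -
  obtain U d where U: "unitary U" "\<And>i. 0 < d i" "A = spec U d"
    by (rule pos_def_spectral[OF loewner_interval_pos_def[OF assms(1,2)]]) blast
  have "\<forall>i. a \<le> d i \<and> d i \<le> b"
    using assms(1) unfolding U(3) spec_in_loewner_interval[OF U(1)] .
  hence "\<forall>i. a powr r \<le> d i powr r \<and> d i powr r \<le> b powr r"
    using U(2) assms(2,3) by (meson less_imp_le powr_mono2)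
  thus ?thesis unfolding U(3) spec_powr[OF U(1)] spec_in_loewner_interval[OF U(1)] .
qed

lemma pos_def_hermitian: "A \<in> pos_def \<Longrightarrow> hermitian A"
  by (simp add: pos_def_def)

lemma pos_def_adj: "A \<in> pos_def \<Longrightarrow> adj A = A"
  by (simp add: pos_def_def hermitian_def)

lemma pos_def_powr_inverse:
  assumes "A \<in> pos_def"
  shows "A powr\<^sub>M r ** A powr\<^sub>M (- r) = mat 1" "A powr\<^sub>M (- r) ** A powr\<^sub>M r = mat 1"
  using assms by (simp_all add: pos_def_powr_add pos_def_powr_0)

lemma powr_intertwine:
  assumes "A \<in> pos_def" "B \<in> pos_def" "A ** T = T ** B"
  shows "A powr\<^sub>M r ** T = T ** B powr\<^sub>M r"
proof -
  obtain U d where U: "unitary U" "A = spec U d" by (rule pos_def_spectral[OF assms(1)]) blast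
  obtain V e where V: "unitary V" "B = spec V e" by (rule pos_def_spectral[OF assms(2)]) blast
  show ?thesis
    using spec_intertwine[OF U(1) V(1), of d T e "\<lambda>x. x powr r"] assms(3) U V
    by (simp add: spec_powr)
qed

lemma cip_congruence: "cip v ((adj T ** A ** T) *v v) = cip (T *v v) (A *v (T *v v))"
  using cip_adj[of v "adj T" "A *v (T *v v)"] by (simp flip: matrix_vector_mul_assoc)

text \<open>The left inverse R is the form in which injectivity of T is supplied.\<close>

lemma pos_def_congruence:
  assumes A: "A \<in> pos_def" and "R ** T = mat 1"
  shows "adj T ** A ** T \<in> pos_def"
proof -
  have "hermitian (adj T ** A ** T)"
    using pos_def_adj[OF A] by (simp add: hermitian_def adj_mult matrix_mul_assoc)
  moreover have "0 < Re (cip v ((adj T ** A ** T) *v v))" if "v \<noteq> 0" for v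
  proof -
    have "T *v v \<noteq> 0"
    proof
      assume "T *v v = 0"
      hence "(R ** T) *v v = 0" by (simp flip: matrix_vector_mul_assoc)
      thus False using assms(2) that by simp
    qed
    hence "0 < Re (cip (T *v v) (A *v (T *v v)))"
      using A by (simp add: pos_def_def quad_form_cip)
    thus ?thesis unfolding cip_congruence .
  qed
  ultimately show ?thesis by (simp add: pos_def_def quad_form_cip)
qed

section \<open>Compactness and convexity of order intervals, continuity of powers\<close>

lemma compact_unitary: "compact {U :: complex^'m^'m. unitary U}"
proof -
  have "closed {U :: complex^'m^'m. unitary U}"
    unfolding unitary_def adj_def
    by (intro closed_Collect_conj closed_Collect_eq continuous_intros continuous_on_vec_lambda)
  moreover have "norm U \<le> (\<Sum>i\<in>(UNIV::'m set). \<Sum>j\<in>(UNIV::'m set). 1)"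
    if U: "unitary (U :: complex^'m^'m)" for U
  proof -
    \<comment> \<open>Every column of U is a unit vector, which bounds each entry.\<close>
    have 1: "norm (U $ i $ j) \<le> 1" for i j
      using Finite_Cartesian_Product.norm_nth_le[of "U *v axis j 1" i] spec_column(2)[OF U, of j]
      by (simp add: matrix_vector_mult_def axis_def mult_delta_right)
    have "norm U \<le> (\<Sum>i\<in>UNIV. norm (U $ i))"
      unfolding norm_vec_def by (intro L2_set_le_sum) auto
    also have "\<dots> \<le> (\<Sum>i\<in>(UNIV::'m set). \<Sum>j\<in>(UNIV::'m set). norm (U $ i $ j))"
      by (intro sum_mono) (unfold norm_vec_def[where 'a=complex], intro L2_set_le_sum, auto)
    also have "\<dots> \<le> (\<Sum>i\<in>(UNIV::'m set). \<Sum>j\<in>(UNIV::'m set). 1)"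
      by (intro sum_mono 1)
    finally show ?thesis .
  qed
  ultimately show ?thesis
    unfolding compact_eq_bounded_closed bounded_iff by blast
qed

text \<open>The eigenvalues are packed into a vector so that they range over a compact box.
  Different pairs (U, d) may give the same matrix; compactness of the image is unaffected.\<close>

lemma loewner_interval_eq_image:
  "(loewner_interval a b :: (complex^'m^'m) set) = (\<lambda>(U, d). spec U (\<lambda>i. d $ i)) ` ({U. unitary U} \<times> cbox (\<chi> i. a) (\<chi> i. b))"
  (is "_ = ?f ` ?C")
proof (intro equalityI subsetI)
  fix A :: "complex^'m^'m" assume A: "A \<in> loewner_interval a b"
  then obtain U d where U: "unitary U" "A = spec U d"
    by (auto elim: hermitian_spectral simp: spec_def loewner_interval_def)
  have "A = ?f (U, \<chi> i. d i)" by (simp add: U vec_lambda_inverse)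
  moreover have "(U, \<chi> i. d i) \<in> ?C"
    using A U by (auto simp: spec_in_loewner_interval mem_box_cart)
  ultimately show "A \<in> ?f ` ?C" by blast
qed (auto simp: spec_in_loewner_interval mem_box_cart)

lemma continuous_on_spec:
  assumes "\<And>i. continuous_on S (\<lambda>x. d x i)" "continuous_on S U"
  shows "continuous_on S (\<lambda>x. spec (U x) (d x))"
proof -
  have "continuous_on S (\<lambda>x. real_diag (d x))"
    unfolding real_diag_def
  proof (intro continuous_on_vec_lambda)
    show "continuous_on S (\<lambda>x. if i = j then complex_of_real (d x i) else 0)" for i j
      using assms(1) by (cases "i = j") (auto intro: continuous_on_of_real)
  qed
  moreover have "continuous_on S (\<lambda>x. adj (U x))"
    unfolding adj_def by (intro continuous_intros continuous_on_vec_lambda assms)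
  ultimately show ?thesis
    unfolding spec_def using assms(2) by (intro continuous_intros)
qed

lemma compact_loewner_interval: "compact (loewner_interval a b)"
  unfolding loewner_interval_eq_image
  by (intro compact_continuous_image compact_Times compact_unitary compact_cbox)
     (auto simp: case_prod_unfold intro!: continuous_on_spec continuous_intros)

lemma Re_cip_combination:
  fixes X :: "'i \<Rightarrow> complex^'m^'m"
  shows "Re (cip x ((\<Sum>i\<in>I. w i *\<^sub>R X i) *v y)) = (\<Sum>i\<in>I. w i * Re (cip x (X i *v y)))"
  by (induction I rule: infinite_finite_induct)
     (auto simp: matrix_vector_mult_add_rdistrib mat_scaleR_vec)

lemma loewner_interval_combination:
  assumes "\<And>i. i \<in> I \<Longrightarrow> X i \<in> loewner_interval a b" "\<And>i. i \<in> I \<Longrightarrow> 0 \<le> w i" "sum w I = 1"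
  shows "(\<Sum>i\<in>I. w i *\<^sub>R X i) \<in> loewner_interval a b"
proof -
  have "hermitian (\<Sum>i\<in>I. w i *\<^sub>R X i)"
    using assms(1) by (simp add: hermitian_def adj_sum loewner_interval_def)
  moreover have "a * (norm v)\<^sup>2 \<le> (\<Sum>i\<in>I. w i * Re (cip v (X i *v v)))" for v
  proof -
    have "a * (norm v)\<^sup>2 = (\<Sum>i\<in>I. w i * (a * (norm v)\<^sup>2))"
      using assms(3) by (simp flip: sum_distrib_right)
    also have "\<dots> \<le> (\<Sum>i\<in>I. w i * Re (cip v (X i *v v)))"
      using assms(1,2) by (intro sum_mono mult_left_mono) (auto simp: loewner_interval_def)
    finally show ?thesis .
  qed
  moreover have "(\<Sum>i\<in>I. w i * Re (cip v (X i *v v))) \<le> b * (norm v)\<^sup>2" for v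
  proof -
    have "(\<Sum>i\<in>I. w i * Re (cip v (X i *v v))) \<le> (\<Sum>i\<in>I. w i * (b * (norm v)\<^sup>2))"
      using assms(1,2) by (intro sum_mono mult_left_mono) (auto simp: loewner_interval_def)
    also have "\<dots> = b * (norm v)\<^sup>2"
      using assms(3) by (simp flip: sum_distrib_right)
    finally show ?thesis .
  qed
  ultimately show ?thesis by (simp add: loewner_interval_def Re_cip_combination)
qed

lemma convex_loewner_interval: "convex (loewner_interval a b)"
  unfolding convex_alt
proof (intro ballI allI impI)
  fix X Y :: "complex^'m^'m" and u :: real
  assume "X \<in> loewner_interval a b" "Y \<in> loewner_interval a b" "0 \<le> u \<and> u \<le> 1"
  thus "(1 - u) *\<^sub>R X + u *\<^sub>R Y \<in> loewner_interval a b"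
    using loewner_interval_combination[of "{False, True}" "\<lambda>c. if c then Y else X" a b "\<lambda>c. if c then u else 1 - u"]
    by simp
qed

text \<open>The graph of the power function is a continuous image of the compact set of all
  spectral data, hence closed.\<close>

lemma continuous_on_mat_powr:
  assumes "0 < a" "0 \<le> r"
  shows "continuous_on (loewner_interval a b :: (complex^'m^'m) set) (\<lambda>A. A powr\<^sub>M r)"
proof (rule continuous_from_closed_graph[OF compact_loewner_interval[of "a powr r" "b powr r"]])
  show "(\<lambda>A. A powr\<^sub>M r) \<in> loewner_interval a b \<rightarrow> (loewner_interval (a powr r) (b powr r) :: (complex^'m^'m) set)"
    using powr_in_loewner_interval assms by blast
  let ?C = "{U :: complex^'m^'m. unitary U} \<times> cbox (\<chi> i. a) (\<chi> i. b)"
  \<comment> \<open>A matrix and its power come from the same pair (U, d). This avoids choosing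
    eigenvectors continuously, which can fail at repeated eigenvalues.\<close>
  have "(\<lambda>A. (A, A powr\<^sub>M r)) ` loewner_interval a b =
      (\<lambda>(U, d). (spec U (\<lambda>i. d $ i), spec U (\<lambda>i. d $ i powr r))) ` ?C"
    unfolding loewner_interval_eq_image image_image
    by (intro image_cong) (auto simp: spec_powr)
  moreover have "compact \<dots>"
    using assms
    by (intro compact_continuous_image compact_Times compact_unitary compact_cbox)
       (auto simp: case_prod_unfold mem_box_cart intro!: continuous_on_spec continuous_intros,
        (metis less_le_trans order_less_irrefl)+)
  ultimately show "closed ((\<lambda>A :: complex^'m^'m. (A, A powr\<^sub>M r)) ` loewner_interval a b)"
    by (simp add: compact_imp_closed)
qed

section \<open>Klein's inequality\<close>

text \<open>Division by x^z leaves the strict weighted inequality of means t^z < u, where t = y/x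
  and u = 1 - z + z t. It comes from ln s \<le> s - 1 at s = t/u and s = 1/u with weights z and 1 -
  z: the right-hand sides average to 0, and strictness comes from 1/u \<noteq> 1.\<close>

lemma powr_less_tangent:
  fixes x y z :: real
  assumes "0 < x" "0 < y" "x \<noteq> y" "0 < z" "z < 1"
  shows "y powr z < x powr z + z * x powr (z - 1) * (y - x)"
proof -
  define t where "t = y / x"
  define u where "u = 1 + z * (t - 1)"
  have t: "0 < t" "t \<noteq> 1" using assms by (auto simp: t_def)
  have "u = (1 - z) + z * t" by (simp add: u_def algebra_simps)
  note u_alt = this
  hence u: "0 < u" using assms t by (simp add: add_pos_pos)
  have u1: "1 / u \<noteq> 1" using assms t by (auto simp: u_def)
  have "ln (t / u) \<le> t / u - 1" using t u by (intro ln_le_minus_one) auto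
  moreover have "ln (1 / u) < 1 / u - 1"
    using u u1 ln_le_minus_one[of "1 / u"] ln_eq_minus_one[of "1 / u"] by fastforce
  ultimately have "z * ln (t / u) + (1 - z) * ln (1 / u) < z * (t / u - 1) + (1 - z) * (1 / u - 1)"
    using assms by (intro add_le_less_mono mult_left_mono mult_strict_left_mono) auto
  also have "\<dots> = ((1 - z) + z * t) / u - 1"
    by (simp add: algebra_simps add_divide_distrib diff_divide_distrib)
  also have "\<dots> = 0" using u u_alt by simp
  finally have "z * ln t < ln u"
    using t u by (simp add: ln_div algebra_simps)
  hence "t powr z < u" using t u by (metis exp_less_cancel_iff exp_ln mult.commute powr_def less_irrefl)
  hence "x powr z * t powr z < x powr z * u" using assms by simp
  moreover have "x powr z * t powr z = y powr z"
    using assms by (simp add: t_def powr_divide)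
  moreover have "x powr z * u = x powr z + z * x powr (z - 1) * (y - x)"
    using assms by (simp add: u_def t_def powr_diff field_simps)
  ultimately show ?thesis by simp
qed

text \<open>The inverse function has the concave exponent 1/q: its tangent inequality at x^q and
  y^q, multiplied by q x^(q-1) > 0, is the claim.\<close>

lemma powr_ge_tangent:
  fixes x y q :: real
  assumes "0 < x" "0 < y" "1 \<le> q"
  shows "x powr q + q * x powr (q - 1) * (y - x) \<le> y powr q"
proof (cases "q = 1 \<or> x = y")
  case True
  thus ?thesis using assms by auto
next
  case False
  hence q: "1 < q" using assms by auto
  have "x powr q \<noteq> y powr q"
    using False assms q powr_less_mono2[of q x y] powr_less_mono2[of q y x] by linarith
  hence "(y powr q) powr (1 / q) < (x powr q) powr (1 / q) +
      (1 / q) * (x powr q) powr (1 / q - 1) * (y powr q - x powr q)"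
    using assms q by (intro powr_less_tangent) auto
  moreover have "q * (1 / q - 1) = 1 - q" using q by (simp add: field_simps)
  ultimately have "y < x + (1 / q) * x powr (1 - q) * (y powr q - x powr q)"
    using assms q by (simp add: powr_powr)
  hence "q * x powr (q - 1) * (y - x) < q * x powr (q - 1) * ((1 / q) * x powr (1 - q) * (y powr q - x powr q))"
    using assms q by (intro mult_strict_left_mono) auto
  also have "\<dots> = (x powr (q - 1) * x powr (1 - q)) * (y powr q - x powr q)"
    using q by simp
  also have "x powr (q - 1) * x powr (1 - q) = 1"
    using assms by (simp flip: powr_add)
  finally show ?thesis by simp
qed

section \<open>Traces in spectral coordinates\<close>

lemma scaleR_mult_left: "(r *\<^sub>R A) ** B = r *\<^sub>R (A ** B)" for A B :: "complex^'m^'m"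
  by (simp add: vec_eq_iff matrix_matrix_mult_def scaleR_sum_right)

lemma scaleR_mult_right: "A ** (r *\<^sub>R B) = r *\<^sub>R (A ** B)" for A B :: "complex^'m^'m"
  by (simp add: vec_eq_iff matrix_matrix_mult_def scaleR_sum_right)

lemma matrix_diff_ldistrib: "A ** (B - C) = A ** B - A ** C" for A :: "complex^'m^'m"
  by (simp add: vec_eq_iff matrix_matrix_mult_def right_diff_distrib sum_subtractf)

lemma matrix_diff_rdistrib: "(B - C) ** A = B ** A - C ** A" for A :: "complex^'m^'m"
  by (simp add: vec_eq_iff matrix_matrix_mult_def left_diff_distrib sum_subtractf)

lemma trace_scaleR: "trace (r *\<^sub>R A) = r *\<^sub>R trace A" for A :: "complex^'m^'m"
  by (simp add: trace_def scaleR_sum_right)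

lemma trace_spec:
  assumes "unitary U"
  shows "trace (spec U d) = of_real (\<Sum>i\<in>UNIV. d i)"
proof -
  have "trace (spec U d) = trace (adj U ** (U ** real_diag d))"
    unfolding spec_def by (rule trace_mul_sym)
  also have "\<dots> = trace (real_diag d)"
    by (simp add: matrix_mul_assoc unitary_cancel[OF assms])
  finally show ?thesis by (simp add: trace_def real_diag_def)
qed

lemma trace_spec_mult:
  "trace (spec U d ** spec V e) =
     of_real (\<Sum>i\<in>UNIV. \<Sum>j\<in>UNIV. d i * e j * (norm ((adj U ** V) $ i $ j))\<^sup>2)"
proof -
  define W where "W = adj U ** V"
  have "trace (spec U d ** spec V e) = trace (U ** (real_diag d ** W ** real_diag e ** adj V))"
    by (simp add: W_def spec_def matrix_mul_assoc)
  also have "\<dots> = trace (real_diag d ** W ** real_diag e ** adj V ** U)"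
    by (rule trace_mul_sym)
  also have "\<dots> = trace (real_diag d ** W ** real_diag e ** adj W)"
    by (simp add: W_def adj_mult matrix_mul_assoc)
  also have "\<dots> = (\<Sum>i\<in>UNIV. \<Sum>j\<in>UNIV. of_real (d i) * W $ i $ j * of_real (e j) * cnj (W $ i $ j))"
    by (simp add: trace_def matrix_matrix_mult_def[of "real_diag d ** W ** real_diag e"]
        mult_real_diag real_diag_mult adj_def)
  also have "\<dots> = of_real (\<Sum>i\<in>UNIV. \<Sum>j\<in>UNIV. d i * e j * (norm (W $ i $ j))\<^sup>2)"
    unfolding of_real_sum of_real_mult complex_norm_square by (simp add: mult_ac)
  finally show ?thesis by (simp add: W_def)
qed

lemma unitary_row_column_sums:
  fixes W :: "complex^'m^'m"
  assumes "unitary W"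
  shows "(\<Sum>j\<in>UNIV. (norm (W $ i $ j))\<^sup>2) = 1" "(\<Sum>i\<in>UNIV. (norm (W $ i $ j))\<^sup>2) = 1"
proof -
  have "complex_of_real (\<Sum>j\<in>UNIV. (norm (W $ i $ j))\<^sup>2) = (W ** adj W) $ i $ i"
    unfolding of_real_sum complex_norm_square by (simp add: matrix_matrix_mult_def adj_def)
  also have "\<dots> = 1" by (simp add: unitary_cancel[OF assms] mat_def)
  finally show "(\<Sum>j\<in>UNIV. (norm (W $ i $ j))\<^sup>2) = 1" by (simp only: of_real_eq_1_iff)
  have "complex_of_real (\<Sum>i\<in>UNIV. (norm (W $ i $ j))\<^sup>2) = (adj W ** W) $ j $ j"
    unfolding of_real_sum complex_norm_square by (simp add: matrix_matrix_mult_def adj_def mult.commute)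
  also have "\<dots> = 1" by (simp add: unitary_cancel[OF assms] mat_def)
  finally show "(\<Sum>i\<in>UNIV. (norm (W $ i $ j))\<^sup>2) = 1" by (simp only: of_real_eq_1_iff)
qed

lemma unitary_mult: "unitary U \<Longrightarrow> unitary V \<Longrightarrow> unitary (U ** V)"
  unfolding unitary_def adj_mult by (metis matrix_mul_assoc matrix_mul_lid)

lemma unitary_adj: "unitary U \<Longrightarrow> unitary (adj U)"
  by (simp add: unitary_def)

lemma spec_times: "spec U (\<lambda>i. r * d i) = r *\<^sub>R spec U d"
proof -
  have "real_diag (\<lambda>i. r * d i) = r *\<^sub>R real_diag d"
    by (auto simp: real_diag_def vec_eq_iff scaleR_conv_of_real[where 'a=complex])
  thus ?thesis by (simp add: spec_def scaleR_mult_left scaleR_mult_right)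
qed

text \<open>Klein's inequality: the squared moduli of the entries of \<open>U\<^sup>*V\<close> form a doubly stochastic
  matrix, so both sides are averages over it of the scalar tangent line inequality.\<close>

lemma klein_spec:
  fixes U V :: "complex^'m^'m"
  assumes U: "unitary U" and V: "unitary V"
    and le: "\<And>i j. f (e j) \<le> f (d i) + g (d i) * (e j - d i)"
  defines "R \<equiv> (\<Sum>i\<in>UNIV. f (d i)) + Re (trace (spec U (\<lambda>i. g (d i)) ** (spec V e - spec U d)))"
  shows "(\<Sum>j\<in>UNIV. f (e j)) \<le> R"
    and "(\<And>i j. d i \<noteq> e j \<Longrightarrow> f (e j) < f (d i) + g (d i) * (e j - d i)) \<Longrightarrow>
           spec U d \<noteq> spec V e \<Longrightarrow> (\<Sum>j\<in>UNIV. f (e j)) < R"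
proof -
  define W where "W = adj U ** V"
  have W: "unitary W" unfolding W_def by (intro unitary_mult unitary_adj U V)
  define c where "c i j = (norm (W $ i $ j))\<^sup>2" for i j
  have row: "(\<Sum>j\<in>UNIV. c i j) = 1" for i using unitary_row_column_sums(1)[OF W] by (simp add: c_def)
  have col: "(\<Sum>i\<in>UNIV. c i j) = 1" for j using unitary_row_column_sums(2)[OF W] by (simp add: c_def)
  have c0: "0 \<le> c i j" for i j by (simp add: c_def)
  have L: "(\<Sum>j\<in>UNIV. f (e j)) = (\<Sum>i\<in>UNIV. \<Sum>j\<in>UNIV. c i j * f (e j))"
    by (subst sum.swap) (simp add: col flip: sum_distrib_right)
  have tr: "Re (trace (spec U (\<lambda>i. g (d i)) ** (spec V e - spec U d))) =
      (\<Sum>i\<in>UNIV. \<Sum>j\<in>UNIV. g (d i) * e j * c i j) - (\<Sum>i\<in>UNIV. g (d i) * d i)"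
    by (simp add: matrix_diff_ldistrib trace_sub trace_spec_mult spec_mult[OF U] trace_spec[OF U] c_def W_def)
  have R: "R = (\<Sum>i\<in>UNIV. \<Sum>j\<in>UNIV. c i j * (f (d i) + g (d i) * (e j - d i)))"
  proof -
    have "(\<Sum>j\<in>UNIV. c i j * (f (d i) + g (d i) * (e j - d i))) =
        f (d i) + (\<Sum>j\<in>UNIV. g (d i) * e j * c i j) - g (d i) * d i" for i
    proof -
      have "(\<Sum>j\<in>UNIV. c i j * (f (d i) + g (d i) * (e j - d i))) =
          (\<Sum>j\<in>UNIV. c i j) * f (d i) + (\<Sum>j\<in>UNIV. g (d i) * e j * c i j) - (\<Sum>j\<in>UNIV. c i j) * (g (d i) * d i)"
        unfolding sum_distrib_right sum.distrib[symmetric] sum_subtractf[symmetric]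
        by (intro sum.cong) (auto simp: algebra_simps)
      thus ?thesis by (simp add: row)
    qed
    thus ?thesis unfolding R_def tr by (simp add: sum.distrib sum_subtractf)
  qed
  show "(\<Sum>j\<in>UNIV. f (e j)) \<le> R"
    unfolding L R by (intro sum_mono mult_left_mono le c0)
  assume strict: "\<And>i j. d i \<noteq> e j \<Longrightarrow> f (e j) < f (d i) + g (d i) * (e j - d i)"
    and ne: "spec U d \<noteq> spec V e"
  \<comment> \<open>If W vanished wherever d i and e j differ, it would intertwine the two diagonal
    matrices and the two spectral matrices would coincide. Hence some strict scalar inequality
    carries positive weight.\<close>
  have "\<exists>i j. d i \<noteq> e j \<and> W $ i $ j \<noteq> 0"
  proof (rule ccontr)
    assume "\<not> ?thesis"
    hence "of_real (d i) * W $ i $ j = W $ i $ j * of_real (e j)" for i j by auto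
    hence "real_diag d ** W = W ** real_diag e"
      by (simp add: vec_eq_iff real_diag_mult mult_real_diag)
    hence "U ** (real_diag d ** W) ** adj V = U ** (W ** real_diag e) ** adj V" by simp
    thus False using ne
      by (simp add: W_def spec_def matrix_mul_assoc unitary_cancel[OF U] unitary_cancel[OF V])
  qed
  then obtain i j where ij: "d i \<noteq> e j" "W $ i $ j \<noteq> 0" by blast
  have "c i j * f (e j) < c i j * (f (d i) + g (d i) * (e j - d i))"
    using ij strict by (intro mult_strict_left_mono) (auto simp: c_def)
  hence "(\<Sum>j\<in>UNIV. c i j * f (e j)) < (\<Sum>j\<in>UNIV. c i j * (f (d i) + g (d i) * (e j - d i)))"
    by (intro sum_strict_mono_ex1 ballI mult_left_mono le c0) auto
  thus "(\<Sum>j\<in>UNIV. f (e j)) < R"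
    unfolding L R by (intro sum_strict_mono_ex1 ballI sum_mono mult_left_mono le c0) auto
qed

text \<open>Klein's inequality for x^z with slope z x^(z-1). The gradient z A^(z-1) of the trace
  appears only as the slope of a supporting hyperplane.\<close>

lemma trace_powr_concave:
  assumes "A \<in> pos_def" "B \<in> pos_def" "A \<noteq> B" "0 < z" "z < 1"
  shows "Re (trace (B powr\<^sub>M z)) < Re (trace (A powr\<^sub>M z)) + z * Re (trace (A powr\<^sub>M (z - 1) ** (B - A)))"
proof -
  obtain U d where U: "unitary U" "\<And>i. 0 < d i" "A = spec U d"
    by (rule pos_def_spectral[OF assms(1)]) blast
  obtain V e where V: "unitary V" "\<And>i. 0 < e i" "B = spec V e"
    by (rule pos_def_spectral[OF assms(2)]) blast
  have lt: "e j powr z < d i powr z + z * d i powr (z - 1) * (e j - d i)" if "d i \<noteq> e j" for i j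
    using powr_less_tangent U V that assms by blast
  have le: "e j powr z \<le> d i powr z + z * d i powr (z - 1) * (e j - d i)" for i j
    using lt[of i j] by (cases "d i = e j") auto
  have "(\<Sum>j\<in>UNIV. e j powr z) < (\<Sum>i\<in>UNIV. d i powr z) +
      Re (trace (spec U (\<lambda>i. z * d i powr (z - 1)) ** (spec V e - spec U d)))"
    using klein_spec(2)[OF U(1) V(1), of "\<lambda>x. x powr z" e d "\<lambda>x. z * x powr (z - 1)"] lt le assms(3) U V
    by blast
  moreover have "spec U (\<lambda>i. z * d i powr (z - 1)) = z *\<^sub>R A powr\<^sub>M (z - 1)"
    using U by (simp add: spec_powr spec_times)
  ultimately show ?thesis using U V
    by (simp add: spec_powr trace_spec scaleR_mult_left trace_scaleR)
qed

text \<open>Klein's inequality is phrased with upper tangents, so it is applied to -x^q. Equality is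
  allowed because q = 1, which occurs for \<alpha> = z, makes both sides agree.\<close>

lemma trace_powr_convex:
  assumes "A \<in> pos_def" "B \<in> pos_def" "1 \<le> q"
  shows "Re (trace (A powr\<^sub>M q)) + q * Re (trace (A powr\<^sub>M (q - 1) ** (B - A))) \<le> Re (trace (B powr\<^sub>M q))"
proof -
  obtain U d where U: "unitary U" "\<And>i. 0 < d i" "A = spec U d"
    by (rule pos_def_spectral[OF assms(1)]) blast
  obtain V e where V: "unitary V" "\<And>i. 0 < e i" "B = spec V e"
    by (rule pos_def_spectral[OF assms(2)]) blast
  have le: "- (e j powr q) \<le> - (d i powr q) + - q * d i powr (q - 1) * (e j - d i)" for i j
    using powr_ge_tangent[OF U(2) V(2) assms(3), of i j] by simp
  have "(\<Sum>j\<in>UNIV. - (e j powr q)) \<le> (\<Sum>i\<in>UNIV. - (d i powr q)) +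
      Re (trace (spec U (\<lambda>i. - q * d i powr (q - 1)) ** (spec V e - spec U d)))"
    using klein_spec(1)[OF U(1) V(1), of "\<lambda>x. - (x powr q)" e d "\<lambda>x. - q * x powr (q - 1)"] le
    by blast
  moreover have "spec U (\<lambda>i. - q * d i powr (q - 1)) = (- q) *\<^sub>R A powr\<^sub>M (q - 1)"
    unfolding U(3) spec_powr[OF U(1)] spec_times ..
  moreover have "Re (trace ((- q) *\<^sub>R A powr\<^sub>M (q - 1) ** (B - A))) =
      - q * Re (trace (A powr\<^sub>M (q - 1) ** (B - A)))"
    unfolding scaleR_mult_left trace_scaleR by simp
  ultimately show ?thesis
    using U V by (simp add: spec_powr trace_spec sum_negf)
qed

section \<open>The right mean as a fixed point\<close>

text \<open>With T = C h, the two inner matrices are P = T \<open>adj T\<close> and Q =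
  \<open>adj T\<close> T, and P T = T Q. Hence Q^z = \<open>adj T\<close> T Q^(z-1) =
  \<open>adj T\<close> P^(z-1) T. This exchanges a power of the matrix in the equation for X for the
  gradient in Y.\<close>

lemma adj_congruence_powr:
  assumes h: "h \<in> pos_def" and C: "C \<in> pos_def"
  shows "(h ** (C ** C) ** h) powr\<^sub>M z = h ** C ** (C ** (h ** h) ** C) powr\<^sub>M (z - 1) ** C ** h"
proof -
  define T where "T = C ** h"
  have inv: "C powr\<^sub>M (- 1) ** C = mat 1" "C ** C powr\<^sub>M (- 1) = mat 1"
            "h powr\<^sub>M (- 1) ** h = mat 1" "h ** h powr\<^sub>M (- 1) = mat 1"
    using pos_def_powr_inverse[of _ 1] h C by (metis pos_def_powr_1)+
  have T1: "(h powr\<^sub>M (- 1) ** C powr\<^sub>M (- 1)) ** T = mat 1"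
    unfolding T_def using inv by (metis matrix_mul_assoc matrix_mul_rid)
  have T2: "(C powr\<^sub>M (- 1) ** h powr\<^sub>M (- 1)) ** (h ** C) = mat 1"
    using inv by (metis matrix_mul_assoc matrix_mul_rid)
  define P Q where "P = C ** (h ** h) ** C" and "Q = h ** (C ** C) ** h"
  have one: "mat 1 \<in> pos_def"
    using spec_pos_def[OF unitary_mat_1, of "\<lambda>i. 1"] by (simp add: spec_1)
  have Q: "Q \<in> pos_def"
    using pos_def_congruence[OF one T1] by (simp add: adj_mult pos_def_adj h C Q_def T_def matrix_mul_assoc)
  have P: "P \<in> pos_def"
    using pos_def_congruence[OF one T2] by (simp add: adj_mult pos_def_adj h C P_def matrix_mul_assoc)
  have "P ** T = T ** Q"
    by (simp add: P_def Q_def T_def matrix_mul_assoc)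
  hence "P powr\<^sub>M (z - 1) ** T = T ** Q powr\<^sub>M (z - 1)"
    by (rule powr_intertwine[OF P Q])
  hence "h ** C ** P powr\<^sub>M (z - 1) ** T = h ** C ** T ** Q powr\<^sub>M (z - 1)"
    by (simp flip: matrix_mul_assoc)
  also have "h ** C ** T = Q powr\<^sub>M 1"
    by (simp add: Q_def[symmetric] pos_def_powr_1[OF Q]) (simp add: Q_def T_def matrix_mul_assoc)
  also have "Q powr\<^sub>M 1 ** Q powr\<^sub>M (z - 1) = Q powr\<^sub>M z"
    by (simp add: pos_def_powr_add[OF Q])
  finally show ?thesis by (simp add: P_def Q_def T_def matrix_mul_assoc)
qed

lemma pos_def_congruence_self:
  assumes "C \<in> pos_def" "Y \<in> pos_def"
  shows "C ** Y ** C \<in> pos_def"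
  using pos_def_congruence[OF assms(2), of "C powr\<^sub>M (- 1)" C] pos_def_powr_inverse(2)[OF assms(1), of 1]
  by (simp add: pos_def_adj assms(1) pos_def_powr_1[OF assms(1)])

text \<open>Concavity is pulled back along Y to C Y C: cyclicity of the trace moves the outer
  factors C onto the gradient, and invertibility of C preserves strictness.\<close>

lemma trace_congruence_powr_concave:
  assumes C: "C \<in> pos_def" and Y: "Y \<in> pos_def" and Y': "Y' \<in> pos_def" and ne: "Y \<noteq> Y'"
    and z: "0 < z" "z < 1"
  shows "Re (trace ((C ** Y' ** C) powr\<^sub>M z)) < Re (trace ((C ** Y ** C) powr\<^sub>M z)) +
           z * Re (trace ((C ** (C ** Y ** C) powr\<^sub>M (z - 1) ** C) ** (Y' - Y)))"
proof -
  have inv: "C powr\<^sub>M (- 1) ** C = mat 1" "C ** C powr\<^sub>M (- 1) = mat 1"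
    using pos_def_powr_inverse[OF C, of 1] by (simp_all add: pos_def_powr_1[OF C])
  have "C ** Y ** C \<noteq> C ** Y' ** C"
  proof
    assume "C ** Y ** C = C ** Y' ** C"
    hence "C powr\<^sub>M (- 1) ** (C ** Y ** C) ** C powr\<^sub>M (- 1) =
           C powr\<^sub>M (- 1) ** (C ** Y' ** C) ** C powr\<^sub>M (- 1)" by simp
    moreover have "C powr\<^sub>M (- 1) ** (C ** Z ** C) ** C powr\<^sub>M (- 1) = Z" for Z
      using inv by (metis matrix_mul_assoc matrix_mul_lid matrix_mul_rid)
    ultimately show False using ne by simp
  qed
  note trace_powr_concave[OF pos_def_congruence_self[OF C Y] pos_def_congruence_self[OF C Y'] this z]
  moreover have "trace (Z ** (C ** Y' ** C - C ** Y ** C)) = trace (C ** Z ** C ** (Y' - Y))" for Z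
  proof -
    have "C ** Y' ** C - C ** Y ** C = C ** (Y' - Y) ** C"
      by (simp add: matrix_diff_ldistrib matrix_diff_rdistrib)
    hence "trace (Z ** (C ** Y' ** C - C ** Y ** C)) = trace ((Z ** C ** (Y' - Y)) ** C)"
      by (simp add: matrix_mul_assoc)
    also have "\<dots> = trace (C ** (Z ** C ** (Y' - Y)))" by (rule trace_mul_sym)
    finally show ?thesis by (simp add: matrix_mul_assoc)
  qed
  ultimately show ?thesis by (simp add: matrix_mul_assoc)
qed

lemma sum_matrix_mult_left: "A ** (\<Sum>j\<in>J. f j) = (\<Sum>j\<in>J. A ** f j)" for A :: "complex^'m^'m"
  by (induction J rule: infinite_finite_induct) (auto simp: matrix_add_ldistrib)

lemma matrix_add_rdistrib: "(B + C) ** A = B ** A + C ** A" for A :: "complex^'m^'m"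
  by (simp add: vec_eq_iff matrix_matrix_mult_def distrib_right sum.distrib)

lemma sum_matrix_mult_right: "(\<Sum>j\<in>J. f j) ** A = (\<Sum>j\<in>J. f j ** A)" for A :: "complex^'m^'m"
  by (induction J rule: infinite_finite_induct) (auto simp: matrix_add_rdistrib)

lemma trace_sum: "trace (\<Sum>j\<in>J. f j) = (\<Sum>j\<in>J. trace (f j))" for f :: "_ \<Rightarrow> complex^'m^'m"
  unfolding trace_def sum_component by (rule sum.swap)

text \<open>In terms of \<open>Y = X\<^bsup>\<alpha>/z\<^esup>\<close> the equation for \<open>X\<close> says that the gradient of the objective
  vanishes, and Klein's inequality makes a critical point a strict global minimum.\<close>

lemma fixed_point_minimizes:
  fixes A :: "nat \<Rightarrow> complex^'m^'m"
  assumes n: "n \<ge> 1" and A: "\<And>j. j \<in> {1..n} \<Longrightarrow> A j \<in> pos_def"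
    and w: "w \<in> pos_prob_vecs n" and z: "0 < \<alpha>" "\<alpha> \<le> z" "z < 1"
    and X: "X \<in> pos_def" and X': "X' \<in> pos_def" "X' \<noteq> X"
    and fp: "X = (\<Sum>j=1..n. w j *\<^sub>R (X powr\<^sub>M (\<alpha> / (2 * z)) ** A j powr\<^sub>M ((1 - \<alpha>) / z)
                      ** X powr\<^sub>M (\<alpha> / (2 * z))) powr\<^sub>M z)"
  shows "(\<Sum>j=1..n. w j * bw_divergence \<alpha> z (A j) X) < (\<Sum>j=1..n. w j * bw_divergence \<alpha> z (A j) X')"
proof -
  \<comment> \<open>Here h is the square root of Y, k its inverse, and q the exponent with Y^q = X;
    the hypothesis \<alpha> \<le> z gives q \<ge> 1.\<close>
  define Y Y' h k q where "Y = X powr\<^sub>M (\<alpha> / z)" and "Y' = X' powr\<^sub>M (\<alpha> / z)"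
    and "h = X powr\<^sub>M (\<alpha> / (2 * z))" and "k = X powr\<^sub>M (- \<alpha> / (2 * z))" and "q = z / \<alpha>"
  define C where "C j = A j powr\<^sub>M ((1 - \<alpha>) / (2 * z))" for j
  define G where "G j = C j ** (C j ** Y ** C j) powr\<^sub>M (z - 1) ** C j" for j
  define T where "T = (\<lambda>j Z. Re (trace ((C j ** Z ** C j) powr\<^sub>M z)))"
  have w0: "0 < w j" if "j \<in> {1..n}" for j using w that by (simp add: pos_prob_vecs_def)
  have w1: "(\<Sum>j=1..n. w j) = 1" using w by (simp add: pos_prob_vecs_def)
  have Y: "Y \<in> pos_def" and Y': "Y' \<in> pos_def" and h: "h \<in> pos_def"
    unfolding Y_def Y'_def h_def by (intro powr_pos_def X X')+
  have C: "C j \<in> pos_def" if "j \<in> {1..n}" for j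
    unfolding C_def by (intro powr_pos_def A that)
  have q: "1 \<le> q" "\<alpha> * q = z" using z by (auto simp: q_def)
  have Yq: "Y powr\<^sub>M q = X" "Y' powr\<^sub>M q = X'"
    using z by (simp_all add: Y_def Y'_def q_def pos_def_powr_powr pos_def_powr_1 X X')
  hence ne: "Y \<noteq> Y'" using X' by auto
  have hh: "h ** h = Y" using z by (simp add: h_def Y_def pos_def_powr_add X field_simps)
  have kh: "k ** h = mat 1" "h ** k = mat 1"
    using z by (simp_all add: k_def h_def pos_def_powr_add pos_def_powr_0 X)
  \<comment> \<open>Up to the factor q, the matrix Y^(q-1) is the gradient of tr Y^q = tr X, so
    conjugating the equation by k turns it into the stationarity condition
    \<open>grad\<close>.\<close>
  have kXk: "k ** X ** k = Y powr\<^sub>M (q - 1)"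
  proof -
    have "- \<alpha> / (2 * z) + 1 + - \<alpha> / (2 * z) = 1 - \<alpha> / z" using z by (simp add: field_simps)
    hence "k ** X powr\<^sub>M 1 ** k = X powr\<^sub>M (1 - \<alpha> / z)"
      unfolding k_def pos_def_powr_add[OF X] by simp
    also have "1 - \<alpha> / z = \<alpha> / z * (q - 1)" using z by (simp add: q_def field_simps)
    also have "X powr\<^sub>M (\<alpha> / z * (q - 1)) = Y powr\<^sub>M (q - 1)"
      unfolding Y_def pos_def_powr_powr[OF X] ..
    finally show ?thesis by (simp add: pos_def_powr_1 X)
  qed
  have "(h ** A j powr\<^sub>M ((1 - \<alpha>) / z) ** h) powr\<^sub>M z = h ** G j ** h" if "j \<in> {1..n}" for j
  proof -
    have "C j ** C j = A j powr\<^sub>M ((1 - \<alpha>) / z)"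
      unfolding C_def pos_def_powr_add[OF A[OF that]] by simp
    thus ?thesis
      using adj_congruence_powr[OF h C[OF that], of z] by (simp add: G_def hh matrix_mul_assoc)
  qed
  hence "X = (\<Sum>j=1..n. w j *\<^sub>R (h ** G j ** h))"
    using fp by (simp add: h_def)
  hence "k ** X ** k = k ** (\<Sum>j=1..n. w j *\<^sub>R (h ** G j ** h)) ** k" by simp
  also have "\<dots> = (\<Sum>j=1..n. w j *\<^sub>R ((k ** h) ** G j ** (h ** k)))"
    by (simp add: sum_matrix_mult_left sum_matrix_mult_right scaleR_mult_left scaleR_mult_right matrix_mul_assoc)
  finally have grad: "Y powr\<^sub>M (q - 1) = (\<Sum>j=1..n. w j *\<^sub>R G j)"
    by (simp add: kXk kh)
  have F: "(\<Sum>j=1..n. w j * bw_divergence \<alpha> z (A j) Z) =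
      (\<Sum>j=1..n. w j * ((1 - \<alpha>) * Re (trace (A j)))) + \<alpha> * Re (trace Z)
       - (\<Sum>j=1..n. w j * T j (Z powr\<^sub>M (\<alpha> / z)))" for Z
  proof -
    have bw: "bw_divergence \<alpha> z (A j) Z =
        (1 - \<alpha>) * Re (trace (A j)) + \<alpha> * Re (trace Z) - T j (Z powr\<^sub>M (\<alpha> / z))" for j
      by (simp add: bw_divergence_def T_def C_def trace_add trace_scaleR)
    have "(\<Sum>j=1..n. w j * bw_divergence \<alpha> z (A j) Z) =
      (\<Sum>j=1..n. w j * ((1 - \<alpha>) * Re (trace (A j)))) + (\<Sum>j=1..n. w j) * (\<alpha> * Re (trace Z))
       - (\<Sum>j=1..n. w j * T j (Z powr\<^sub>M (\<alpha> / z)))"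
      unfolding bw sum_distrib_right sum.distrib[symmetric] sum_subtractf[symmetric]
      by (intro sum.cong) (simp_all add: algebra_simps)
    thus ?thesis by (simp only: w1 mult_1)
  qed
  have "(\<Sum>j=1..n. w j * T j Y') < (\<Sum>j=1..n. w j * (T j Y + z * Re (trace (G j ** (Y' - Y)))))"
  proof (rule sum_strict_mono)
    fix j assume j: "j \<in> {1..n}"
    show "w j * T j Y' < w j * (T j Y + z * Re (trace (G j ** (Y' - Y))))"
      unfolding T_def G_def
      using trace_congruence_powr_concave[OF C[OF j] Y Y' ne _ z(3)] w0[OF j] z
      by (intro mult_strict_left_mono) auto
  qed (use n in auto)
  also have "\<dots> = (\<Sum>j=1..n. w j * T j Y) + z * Re (trace ((\<Sum>j=1..n. w j *\<^sub>R G j) ** (Y' - Y)))"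
    by (simp add: sum_matrix_mult_right trace_sum scaleR_mult_left trace_scaleR sum.distrib
        sum_distrib_left algebra_simps)
  \<comment> \<open>Because \<alpha> q = z, the linear bound for the concave part is also the linear
    bound for the convex part \<alpha> tr Y^q, so the two tangent inequalities can be
    chained.\<close>
  also have "\<dots> = (\<Sum>j=1..n. w j * T j Y) + \<alpha> * (q * Re (trace (Y powr\<^sub>M (q - 1) ** (Y' - Y))))"
    unfolding grad using q by (simp flip: mult.assoc)
  also have "\<dots> \<le> (\<Sum>j=1..n. w j * T j Y) + \<alpha> * (Re (trace X') - Re (trace X))"
    using trace_powr_convex[OF Y Y' q(1)] z unfolding Yq
    by (intro add_left_mono mult_left_mono) auto
  finally show ?thesis
    unfolding F by (simp add: Y_def Y'_def algebra_simps)
qed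

text \<open>\<open>A j\<close> stands here for the power A_j^((1-\<alpha>)/z). The condition
  \<alpha> < 1 makes the scalar version of the equation, c^(1-\<alpha>) = l^z, solvable, and its
  solutions bound the invariant interval.\<close>

lemma fixed_point_exists:
  fixes A :: "nat \<Rightarrow> complex^'m^'m"
  assumes n: "n \<ge> 1" and A: "\<And>j. j \<in> {1..n} \<Longrightarrow> A j \<in> pos_def"
    and w: "w \<in> pos_prob_vecs n" and z: "0 < \<alpha>" "\<alpha> < 1" "0 < z"
  shows "\<exists>X \<in> pos_def. X = (\<Sum>j=1..n. w j *\<^sub>R (X powr\<^sub>M (\<alpha> / (2 * z)) ** A j
                      ** X powr\<^sub>M (\<alpha> / (2 * z))) powr\<^sub>M z)"
proof -
  have w0: "0 < w j" if "j \<in> {1..n}" for j using w that by (simp add: pos_prob_vecs_def)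
  have w1: "(\<Sum>j=1..n. w j) = 1" using w by (simp add: pos_prob_vecs_def)
  have "\<exists>a b. 0 < a \<and> A j \<in> loewner_interval a b" if "j \<in> {1..n}" for j
    by (rule pos_def_in_loewner_interval[OF A[OF that]]) blast
  then obtain lo hi where lohi: "\<And>j. j \<in> {1..n} \<Longrightarrow> 0 < lo j \<and> A j \<in> loewner_interval (lo j) (hi j)"
    by metis
  define l u where "l = Min (lo ` {1..n})" and "u = Max (hi ` {1..n})"
  have l0: "0 < l" unfolding l_def using n lohi by (subst Min_gr_iff) auto
  have Alu: "A j \<in> loewner_interval l u" if "j \<in> {1..n}" for j
    using lohi[OF that] that by (auto simp: l_def u_def intro: loewner_interval_mono)
  have lu: "l \<le> u" using loewner_interval_le[OF Alu[of 1]] n by auto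
  \<comment> \<open>These solve c = (l c^(\<alpha>/z))^z and c = (u c^(\<alpha>/z))^z: they are the
    fixed points obtained when every \<open>A j\<close> is the scalar matrix l or u.\<close>
  define a b where "a = l powr (z / (1 - \<alpha>))" and "b = u powr (z / (1 - \<alpha>))"
  have a0: "0 < a" using l0 by (simp add: a_def)
  have ab: "a \<le> b" unfolding a_def b_def using l0 lu z by (intro powr_mono2) auto
  have ca: "(l * a powr (\<alpha> / z)) powr z = a" and cb: "(u * b powr (\<alpha> / z)) powr z = b"
  proof -
    have "z + \<alpha> * z / (1 - \<alpha>) = z / (1 - \<alpha>)" using z by (simp add: field_simps)
    hence "(c * (c powr (z / (1 - \<alpha>))) powr (\<alpha> / z)) powr z = c powr (z / (1 - \<alpha>))" if "0 < c" for c
      using that z by (simp add: powr_mult powr_powr mult.commute flip: powr_add)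
    thus "(l * a powr (\<alpha> / z)) powr z = a" "(u * b powr (\<alpha> / z)) powr z = b"
      using l0 lu by (auto simp: a_def b_def)
  qed
  define H where "H X = X powr\<^sub>M (\<alpha> / (2 * z))" for X :: "complex^'m^'m"
  define \<Phi> where "\<Phi> X = (\<Sum>j=1..n. w j *\<^sub>R (H X ** A j ** H X) powr\<^sub>M z)" for X
  let ?S = "loewner_interval a b :: (complex^'m^'m) set"
  \<comment> \<open>With H = \<open>H X\<close>, the bounds on \<open>A j\<close> place H (A j) H
    between l H^2 and u H^2, where H^2 = X^(\<alpha>/z). All interval ends are scalar matrices, so
    monotonicity of powers on real numbers suffices.\<close>
  have inner: "H X ** A j ** H X \<in> loewner_interval (l * a powr (\<alpha> / z)) (u * b powr (\<alpha> / z))"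
    if X: "X \<in> ?S" and j: "j \<in> {1..n}" for X j
  proof -
    have Xp: "X \<in> pos_def" using loewner_interval_pos_def[OF X a0] .
    have Hp: "H X \<in> pos_def" unfolding H_def by (rule powr_pos_def[OF Xp])
    have HH: "H X ** H X = X powr\<^sub>M (\<alpha> / z)"
      unfolding H_def pos_def_powr_add[OF Xp] using z by (simp add: field_simps)
    have XX: "X powr\<^sub>M (\<alpha> / z) \<in> loewner_interval (a powr (\<alpha> / z)) (b powr (\<alpha> / z))"
      using X a0 z by (intro powr_in_loewner_interval) auto
    have nH: "(norm (H X *v v))\<^sup>2 = Re (cip v (X powr\<^sub>M (\<alpha> / z) *v v))" for v
      using cip_congruence[of v "H X" "mat 1"] pos_def_adj[OF Hp] HH by (simp add: cip_self flip: of_real_power)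
    have "l * a powr (\<alpha> / z) * (norm v)\<^sup>2 \<le> Re (cip v ((H X ** A j ** H X) *v v))" for v
    proof -
      have "l * (a powr (\<alpha> / z) * (norm v)\<^sup>2) \<le> l * (norm (H X *v v))\<^sup>2"
        unfolding nH using XX l0 by (intro mult_left_mono) (auto simp: loewner_interval_def)
      also have "\<dots> \<le> Re (cip (H X *v v) (A j *v (H X *v v)))"
        using Alu[OF j] by (auto simp: loewner_interval_def)
      finally show ?thesis
        using cip_congruence[of v "H X" "A j"] pos_def_adj[OF Hp] by (simp add: mult.assoc)
    qed
    moreover have "Re (cip v ((H X ** A j ** H X) *v v)) \<le> u * b powr (\<alpha> / z) * (norm v)\<^sup>2" for v
    proof -
      have "Re (cip (H X *v v) (A j *v (H X *v v))) \<le> u * (norm (H X *v v))\<^sup>2"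
        using Alu[OF j] by (auto simp: loewner_interval_def)
      also have "\<dots> \<le> u * (b powr (\<alpha> / z) * (norm v)\<^sup>2)"
        unfolding nH using XX l0 lu by (intro mult_left_mono) (auto simp: loewner_interval_def)
      finally show ?thesis
        using cip_congruence[of v "H X" "A j"] pos_def_adj[OF Hp] by (simp add: mult.assoc)
    qed
    moreover have "hermitian (H X ** A j ** H X)"
      by (rule pos_def_hermitian[OF pos_def_congruence_self[OF Hp A[OF j]]])
    ultimately show ?thesis by (simp add: loewner_interval_def)
  qed
  have la: "0 < l * a powr (\<alpha> / z)" using l0 a0 by simp
  have "\<Phi> \<in> ?S \<rightarrow> ?S"
  proof
    fix X assume X: "X \<in> ?S"
    have "(H X ** A j ** H X) powr\<^sub>M z \<in> ?S" if "j \<in> {1..n}" for j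
      using powr_in_loewner_interval[OF inner[OF X that] la, of z] z by (simp add: ca cb)
    thus "\<Phi> X \<in> ?S" unfolding \<Phi>_def
      using w0 w1 by (intro loewner_interval_combination) (auto simp: less_imp_le)
  qed
  moreover have "continuous_on ?S \<Phi>"
    unfolding \<Phi>_def
  proof (intro continuous_on_sum continuous_on_scaleR continuous_on_const)
    fix j assume j: "j \<in> {1..n}"
    have "continuous_on ?S H" unfolding H_def
      using a0 z by (intro continuous_on_mat_powr) auto
    hence *: "continuous_on ?S (\<lambda>X. H X ** A j ** H X)" by (intro continuous_intros)
    show "continuous_on ?S (\<lambda>X. (H X ** A j ** H X) powr\<^sub>M z)"
      using inner[OF _ j] z
      by (intro continuous_on_compose2[OF continuous_on_mat_powr[OF la] *]) auto
  qed
  moreover have "?S \<noteq> {}"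
  proof -
    have "spec (mat 1) (\<lambda>i. a) \<in> ?S" using ab by (subst spec_in_loewner_interval) auto
    thus ?thesis by blast
  qed
  ultimately obtain X where "X \<in> ?S" "\<Phi> X = X"
    using brouwer[OF compact_loewner_interval convex_loewner_interval] by blast
  thus ?thesis
    using loewner_interval_pos_def[OF _ a0] by (intro bexI[of _ X]) (auto simp: \<Phi>_def H_def)
qed

text \<open>A solution of the equation lies strictly below every other competitor, so it is the only
  value that the choice in \<open>arg_min_on\<close> can return.\<close>

lemma right_mean_fixed_point:
  fixes A :: "nat \<Rightarrow> complex^'m^'m"
  assumes "n \<ge> 1" "\<And>j. j \<in> {1..n} \<Longrightarrow> A j \<in> pos_def" "w \<in> pos_prob_vecs n"
    and z: "0 < \<alpha>" "\<alpha> \<le> z" "z < 1"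
  defines "X \<equiv> right_mean \<alpha> z n w A"
  shows "X \<in> pos_def"
    and "X = (\<Sum>j=1..n. w j *\<^sub>R (X powr\<^sub>M (\<alpha> / (2 * z)) ** A j powr\<^sub>M ((1 - \<alpha>) / z)
                ** X powr\<^sub>M (\<alpha> / (2 * z))) powr\<^sub>M z)"
proof -
  have Ap: "\<And>j. j \<in> {1..n} \<Longrightarrow> A j powr\<^sub>M ((1 - \<alpha>) / z) \<in> pos_def"
    by (intro powr_pos_def assms(2))
  have "\<alpha> < 1" "0 < z" using z by auto
  from fixed_point_exists[of n "\<lambda>j. A j powr\<^sub>M ((1 - \<alpha>) / z)", OF assms(1) Ap assms(3) z(1) this]
  obtain X0 where X0: "X0 \<in> pos_def"
      "X0 = (\<Sum>j=1..n. w j *\<^sub>R (X0 powr\<^sub>M (\<alpha> / (2 * z)) ** A j powr\<^sub>M ((1 - \<alpha>) / z)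
                ** X0 powr\<^sub>M (\<alpha> / (2 * z))) powr\<^sub>M z)"
    by blast
  define F where "F X = (\<Sum>j=1..n. w j * bw_divergence \<alpha> z (A j) X)" for X
  have less: "F X0 < F X'" if "X' \<in> pos_def" "X' \<noteq> X0" for X'
    unfolding F_def by (rule fixed_point_minimizes[OF assms(1,2,3) z X0(1) that X0(2)])
  hence "is_arg_min F (\<lambda>X. X \<in> pos_def) X0"
    unfolding is_arg_min_def using X0(1) by (metis less_asym less_irrefl)
  hence "is_arg_min F (\<lambda>X. X \<in> pos_def) X"
    unfolding X_def right_mean_def arg_min_on_def arg_min_def F_def by (rule someI)
  hence XX0: "X = X0"
    unfolding is_arg_min_def using X0(1) less by blast
  show "X \<in> pos_def" unfolding XX0 by (rule X0(1))
  show "X = (\<Sum>j=1..n. w j *\<^sub>R (X powr\<^sub>M (\<alpha> / (2 * z)) ** A j powr\<^sub>M ((1 - \<alpha>) / z)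
                ** X powr\<^sub>M (\<alpha> / (2 * z))) powr\<^sub>M z)"
    unfolding XX0 by (rule X0(2))
qed

section \<open>Operator convexity of powers\<close>

lemma pos_def_cip: "A \<in> pos_def \<Longrightarrow> cip x (A *v y) = cip (A *v x) y"
  by (simp add: cip_adj pos_def_adj)

lemma pos_def_cip_powr:
  assumes "A \<in> pos_def"
  shows "cip (A powr\<^sub>M r *v x) (A powr\<^sub>M s *v y) = cip x (A powr\<^sub>M (r + s) *v y)"
  by (simp add: pos_def_cip[OF powr_pos_def[OF assms], symmetric] matrix_vector_mul_assoc
      pos_def_powr_add[OF assms])

lemma matrix_vector_mult_minus: "A *v (- x) = - (A *v x)" for A :: "complex^'m^'m"
  using mat_vec_scaleR[of A "-1" x] by simp

text \<open>The expression is the squared norm of W^(s/2) x + W^(t/2) y. It says that the block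
  matrix with rows (W^s, W^((s+t)/2)) and (W^((s+t)/2), W^t) is positive semidefinite, written as a
  form in two vectors to stay within one matrix size.\<close>

lemma powr_block_psd:
  assumes W: "W \<in> pos_def"
  shows "0 \<le> Re (cip x (W powr\<^sub>M s *v x)) + 2 * Re (cip x (W powr\<^sub>M ((s + t) / 2) *v y))
           + Re (cip y (W powr\<^sub>M t *v y))"
proof -
  define a b where "a = W powr\<^sub>M (s / 2) *v x" and "b = W powr\<^sub>M (t / 2) *v y"
  have "Re (cip b a) = Re (cip a b)" by (metis cnj_cip cnj.sel(1))
  hence "Re (cip (a + b) (a + b)) = Re (cip a a) + 2 * Re (cip a b) + Re (cip b b)"
    by simp
  moreover have "0 \<le> Re (cip (a + b) (a + b))" unfolding cip_self Re_complex_of_real by simp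
  ultimately show ?thesis
    by (simp add: a_def b_def pos_def_cip_powr[OF W] add_divide_distrib)
qed

text \<open>The block matrix condition says that \<open>X\<^bsup>-s/2\<^esup> M X\<^bsup>-t/2\<^esup>\<close> is a contraction. This matrix is similar
  to the Hermitian matrix \<open>X\<^bsup>-(s+t)/4\<^esup> M X\<^bsup>-(s+t)/4\<^esup>\<close>, whose eigenvalues are therefore at most 1.\<close>

lemma block_psd_imp_le_mean:
  fixes X M :: "complex^'m^'m"
  assumes X: "X \<in> pos_def" and M: "hermitian M"
    and block: "\<And>x y. 0 \<le> Re (cip x (X powr\<^sub>M s *v x)) + 2 * Re (cip x (M *v y))
                        + Re (cip y (X powr\<^sub>M t *v y))"
  shows "Re (cip v (M *v v)) \<le> Re (cip v (X powr\<^sub>M ((s + t) / 2) *v v))"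
proof -
  define c where "c = (s + t) / 4"
  define R K where "R = X powr\<^sub>M (- c)" and "K = R ** M ** R"
  have R: "R \<in> pos_def" unfolding R_def by (rule powr_pos_def[OF X])
  have XR: "X powr\<^sub>M c ** R = mat 1" "R ** X powr\<^sub>M c = mat 1"
    unfolding R_def using pos_def_powr_inverse[OF X] by auto
  have "hermitian K"
    using pos_def_adj[OF R] M by (simp add: hermitian_def K_def adj_mult matrix_mul_assoc)
  then obtain U d where U: "unitary U" "K = spec U d"
    by (auto elim: hermitian_spectral simp: spec_def)
  have d1: "d i \<le> 1" for i
  proof -
    define k where "k = U *v axis i 1"
    have "norm k = 1" unfolding k_def by (rule spec_column(2)[OF U(1)])
    hence k0: "k \<noteq> 0" by auto
    have "K *v k = U *v (real_diag d *v axis i 1)"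
      unfolding U(2) spec_def k_def
      by (simp add: matrix_vector_mul_assoc matrix_mul_assoc unitary_cancel[OF U(1)])
    also have "real_diag d *v axis i 1 = d i *\<^sub>R axis i 1"
      by (simp add: vec_eq_iff real_diag_vec axis_def scaleR_conv_of_real[where 'a=complex])
    finally have Kk: "K *v k = d i *\<^sub>R k" by (simp add: mat_vec_scaleR k_def)
    have "X powr\<^sub>M c *v (K *v k) = (X powr\<^sub>M c ** R) *v (M *v (R *v k))"
      by (simp add: K_def matrix_vector_mul_assoc matrix_mul_assoc)
    hence MRk: "M *v (R *v k) = d i *\<^sub>R (X powr\<^sub>M c *v k)"
      by (simp add: XR Kk mat_vec_scaleR)
    \<comment> \<open>The exponents are chosen so that X^(s/2) x = X^(t/2) R k = u, while the inner
      product of x with M R k is d i times that of u with itself. The block form at -x and R k is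
      then 2 (1 - d i) |u|^2.\<close>
    define u x where "u = X powr\<^sub>M ((t - s) / 4) *v k" and "x = X powr\<^sub>M ((t - s) / 4 - s / 2) *v k"
    have "X powr\<^sub>M (- ((t - s) / 4)) *v u = k"
      unfolding u_def matrix_vector_mul_assoc pos_def_powr_inverse[OF X] by simp
    hence "u \<noteq> 0" using k0 by auto
    have "cip x (X powr\<^sub>M s *v x) = cip u u"
      unfolding x_def u_def matrix_vector_mul_assoc pos_def_powr_add[OF X] pos_def_cip_powr[OF X]
      by (simp add: algebra_simps add_divide_distrib diff_divide_distrib)
    moreover have "cip (R *v k) (X powr\<^sub>M t *v (R *v k)) = cip u u"
      unfolding R_def u_def matrix_vector_mul_assoc pos_def_powr_add[OF X] pos_def_cip_powr[OF X]
      by (simp add: c_def algebra_simps add_divide_distrib diff_divide_distrib)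
    moreover have "cip x (X powr\<^sub>M c *v k) = cip u u"
      unfolding x_def u_def pos_def_cip_powr[OF X]
      by (simp add: c_def algebra_simps add_divide_distrib diff_divide_distrib)
    ultimately have "0 \<le> 2 * (1 - d i) * Re (cip u u)"
      using block[of "- x" "R *v k"] by (simp add: MRk matrix_vector_mult_minus algebra_simps)
    moreover have "0 < Re (cip u u)" using \<open>u \<noteq> 0\<close> by (simp add: cip_self flip: of_real_power)
    ultimately show ?thesis by (simp add: zero_le_mult_iff)
  qed
  have "K \<in> loewner_interval (Min (range d)) 1"
    unfolding U(2) spec_in_loewner_interval[OF U(1)] using d1 by auto
  hence "Re (cip (X powr\<^sub>M c *v v) (K *v (X powr\<^sub>M c *v v))) \<le> (norm (X powr\<^sub>M c *v v))\<^sup>2"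
    by (auto simp: loewner_interval_def)
  moreover have "cip (X powr\<^sub>M c *v v) (K *v (X powr\<^sub>M c *v v)) = cip v (M *v v)"
  proof -
    have "cip (X powr\<^sub>M c *v v) (K *v (X powr\<^sub>M c *v v)) = cip v (((X powr\<^sub>M c ** R) ** M ** (R ** X powr\<^sub>M c)) *v v)"
      by (simp add: K_def pos_def_cip[OF powr_pos_def[OF X], symmetric] matrix_vector_mul_assoc matrix_mul_assoc)
    thus ?thesis by (simp add: XR)
  qed
  moreover have "(norm (X powr\<^sub>M c *v v))\<^sup>2 = Re (cip v (X powr\<^sub>M ((s + t) / 2) *v v))"
    using arg_cong[OF pos_def_cip_powr[OF X, of c v c v], of Re]
    by (simp add: cip_self c_def flip: of_real_power)
  ultimately show ?thesis by simp
qed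

text \<open>Take the nearest elements x and y of S on either side of s. Their midpoint lies in S,
  and unless one of them equals s it would be nearer to s on its side.\<close>

lemma closed_midpoint_interval:
  fixes S :: "real set"
  assumes S: "closed S" "a \<in> S" "b \<in> S" and mid: "\<And>x y. x \<in> S \<Longrightarrow> y \<in> S \<Longrightarrow> (x + y) / 2 \<in> S"
  shows "{a..b} \<subseteq> S"
proof
  fix s assume s: "s \<in> {a..b}"
  have "compact (S \<inter> {a..s})" "compact (S \<inter> {s..b})"
    using S by (auto intro: closed_Int_compact)
  moreover have "S \<inter> {a..s} \<noteq> {}" "S \<inter> {s..b} \<noteq> {}" using S s by auto
  ultimately obtain x y where xy: "x \<in> S \<inter> {a..s}" "\<And>u. u \<in> S \<inter> {a..s} \<Longrightarrow> u \<le> x"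
      "y \<in> S \<inter> {s..b}" "\<And>u. u \<in> S \<inter> {s..b} \<Longrightarrow> y \<le> u"
    by (metis compact_attains_sup compact_attains_inf)
  have x: "x \<in> S" "x \<le> s" "\<And>u. u \<in> S \<Longrightarrow> a \<le> u \<Longrightarrow> u \<le> s \<Longrightarrow> u \<le> x" "a \<le> x"
    using xy(1,2) by auto
  have y: "y \<in> S" "s \<le> y" "\<And>u. u \<in> S \<Longrightarrow> s \<le> u \<Longrightarrow> u \<le> b \<Longrightarrow> y \<le> u" "y \<le> b"
    using xy(3,4) by auto
  have "(x + y) / 2 \<in> S" using x y mid by blast
  hence "x = s \<or> y = s"
    using x(2,4) y(2,4) x(3)[of "(x + y) / 2"] y(3)[of "(x + y) / 2"] by (cases "(x + y) / 2 \<le> s") auto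
  thus "s \<in> S" using x y by auto
qed

lemma continuous_on_powr_cip:
  assumes "A \<in> pos_def"
  shows "continuous_on UNIV (\<lambda>s. Re (cip v (A powr\<^sub>M s *v v)))"
proof -
  obtain U d where U: "unitary U" "\<And>i. 0 < d i" "A = spec U d"
    by (rule pos_def_spectral[OF assms]) blast
  have "d i \<noteq> 0" for i using U(2)[of i] by simp
  thus ?thesis
    unfolding U(3) spec_powr[OF U(1)] spec_cip Re_complex_of_real
    by (intro continuous_intros) auto
qed

text \<open>The exponents for which the inequality holds form a closed set containing 0 and 1. It is
  closed under midpoints: in the averaged block matrices the diagonal may be enlarged to X^s and
  X^t, and \<open>block_psd_imp_le_mean\<close> then bounds the off-diagonal average. No integral
  representation of the power is involved.\<close>

lemma powr_concave:
  fixes W :: "'i \<Rightarrow> complex^'m^'m"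
  assumes W: "\<And>j. j \<in> J \<Longrightarrow> W j \<in> pos_def" and w: "\<And>j. j \<in> J \<Longrightarrow> 0 \<le> w j" "sum w J = 1"
    and X: "X \<in> pos_def" "X = (\<Sum>j\<in>J. w j *\<^sub>R W j)" and s: "0 \<le> s" "s \<le> 1"
  shows "(\<Sum>j\<in>J. w j * Re (cip v (W j powr\<^sub>M s *v v))) \<le> Re (cip v (X powr\<^sub>M s *v v))"
proof -
  define S where "S = {s. \<forall>v. (\<Sum>j\<in>J. w j * Re (cip v (W j powr\<^sub>M s *v v))) \<le> Re (cip v (X powr\<^sub>M s *v v))}"
  have "closed S"
    unfolding S_def Collect_all_eq
    by (intro closed_INT ballI closed_Collect_le continuous_on_sum continuous_on_mult
        continuous_on_const continuous_on_powr_cip W X(1))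
  moreover have "0 \<in> S"
    using w by (simp add: S_def pos_def_powr_0 W X(1) flip: sum_distrib_right)
  moreover have "1 \<in> S"
    by (simp add: S_def pos_def_powr_1 W X(1)) (simp add: X(2) Re_cip_combination)
  moreover have "(s + t) / 2 \<in> S" if "s \<in> S" "t \<in> S" for s t
  proof -
    define M where "M = (\<Sum>j\<in>J. w j *\<^sub>R W j powr\<^sub>M ((s + t) / 2))"
    have M: "hermitian M"
      unfolding M_def hermitian_def adj_sum using W by (simp add: pos_def_adj powr_pos_def)
    have Mxy: "Re (cip x (M *v y)) = (\<Sum>j\<in>J. w j * Re (cip x (W j powr\<^sub>M ((s + t) / 2) *v y)))" for x y
      unfolding M_def by (rule Re_cip_combination)
    have "0 \<le> Re (cip x (X powr\<^sub>M s *v x)) + 2 * Re (cip x (M *v y)) + Re (cip y (X powr\<^sub>M t *v y))" for x y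
    proof -
      have "0 \<le> (\<Sum>j\<in>J. w j * (Re (cip x (W j powr\<^sub>M s *v x))
          + 2 * Re (cip x (W j powr\<^sub>M ((s + t) / 2) *v y)) + Re (cip y (W j powr\<^sub>M t *v y))))"
        by (intro sum_nonneg mult_nonneg_nonneg w powr_block_psd W)
      also have "\<dots> = (\<Sum>j\<in>J. w j * Re (cip x (W j powr\<^sub>M s *v x))) + 2 * Re (cip x (M *v y))
          + (\<Sum>j\<in>J. w j * Re (cip y (W j powr\<^sub>M t *v y)))"
        unfolding Mxy by (simp add: sum.distrib sum_distrib_left algebra_simps)
      also have "\<dots> \<le> Re (cip x (X powr\<^sub>M s *v x)) + 2 * Re (cip x (M *v y))
          + Re (cip y (X powr\<^sub>M t *v y))"
        using that unfolding S_def by (intro add_mono order_refl) blast+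
      finally show ?thesis .
    qed
    from block_psd_imp_le_mean[OF X(1) M this]
    show ?thesis unfolding S_def Mxy by blast
  qed
  ultimately have "{0..1} \<subseteq> S" by (rule closed_midpoint_interval)
  thus ?thesis using s by (auto simp: S_def)
qed

text \<open>A Schur complement argument: the sum of the block matrices with rows \<open>(W\<^bsup>r\<^esup>, W)\<close> and
  \<open>(W, W\<^bsup>2-r\<^esup>)\<close> is positive semidefinite, and its lower right entry is at most \<open>X\<^bsup>2-r\<^esup>\<close> by concavity.\<close>

lemma powr_convex:
  fixes W :: "'i \<Rightarrow> complex^'m^'m"
  assumes W: "\<And>j. j \<in> J \<Longrightarrow> W j \<in> pos_def" and w: "\<And>j. j \<in> J \<Longrightarrow> 0 \<le> w j" "sum w J = 1"
    and X: "X \<in> pos_def" "X = (\<Sum>j\<in>J. w j *\<^sub>R W j)" and r: "1 \<le> r" "r \<le> 2"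
  shows "Re (cip v (X powr\<^sub>M r *v v)) \<le> (\<Sum>j\<in>J. w j * Re (cip v (W j powr\<^sub>M r *v v)))"
proof -
  \<comment> \<open>The minimizer of 2 Re (v, X y) + (y, X^(2-r) y) over y, where the value is -(v,
    X^r v). Concavity applies to the exponent 2 - r, which lies in [0, 1].\<close>
  define y where "y = - (X powr\<^sub>M (r - 1) *v v)"
  have Xy: "Re (cip v (X *v y)) = (\<Sum>j\<in>J. w j * Re (cip v (W j *v y)))"
    unfolding X(2) by (rule Re_cip_combination)
  have "0 \<le> (\<Sum>j\<in>J. w j * (Re (cip v (W j powr\<^sub>M r *v v))
      + 2 * Re (cip v (W j powr\<^sub>M ((r + (2 - r)) / 2) *v y)) + Re (cip y (W j powr\<^sub>M (2 - r) *v y))))"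
    by (intro sum_nonneg mult_nonneg_nonneg w powr_block_psd W)
  also have "\<dots> = (\<Sum>j\<in>J. w j * Re (cip v (W j powr\<^sub>M r *v v))) + 2 * Re (cip v (X *v y))
      + (\<Sum>j\<in>J. w j * Re (cip y (W j powr\<^sub>M (2 - r) *v y)))"
    unfolding Xy by (simp add: pos_def_powr_1 W sum.distrib sum_distrib_left algebra_simps)
  also have "(\<Sum>j\<in>J. w j * Re (cip y (W j powr\<^sub>M (2 - r) *v y))) \<le> Re (cip y (X powr\<^sub>M (2 - r) *v y))"
    using r by (intro powr_concave[OF W w X]) auto
  also have "cip y (X powr\<^sub>M (2 - r) *v y) = cip v (X powr\<^sub>M r *v v)"
    by (simp add: y_def matrix_vector_mult_minus matrix_vector_mul_assoc pos_def_powr_add[OF X(1)]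
        pos_def_cip_powr[OF X(1)])
  also have "cip v (X *v y) = - cip v (X powr\<^sub>M r *v v)"
    using pos_def_powr_add[OF X(1), of 1 "r - 1"]
    by (simp add: y_def matrix_vector_mult_minus matrix_vector_mul_assoc pos_def_powr_1[OF X(1)])
  finally show ?thesis by simp
qed

lemma right_mean_powr_le:
  fixes A :: "nat \<Rightarrow> complex^'m^'m"
  assumes n: "n \<ge> 1" and A: "\<And>j. j \<in> {1..n} \<Longrightarrow> A j \<in> pos_def" and w: "w \<in> pos_prob_vecs n"
    and z: "0 < \<alpha>" "\<alpha> \<le> z" "z < 1" "1 / 2 \<le> z"
  shows "right_mean \<alpha> z n w A powr\<^sub>M ((1 - \<alpha>) / z) \<preceq>\<^sub>L (\<Sum>j=1..n. w j *\<^sub>R A j powr\<^sub>M ((1 - \<alpha>) / z))"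
proof -
  define X where "X = right_mean \<alpha> z n w A"
  define p where "p = (1 - \<alpha>) / z"
  define H where "H = X powr\<^sub>M (\<alpha> / (2 * z))"
  define Z where "Z j = H ** A j powr\<^sub>M p ** H" for j
  have X: "X \<in> pos_def" "X = (\<Sum>j=1..n. w j *\<^sub>R Z j powr\<^sub>M z)"
    using right_mean_fixed_point[OF n A w z(1-3)] by (simp_all add: X_def Z_def H_def p_def)
  have w0: "0 \<le> w j" if "j \<in> {1..n}" for j using w that by (simp add: pos_prob_vecs_def less_imp_le)
  have w1: "sum w {1..n} = 1" using w by (simp add: pos_prob_vecs_def)
  have Ap: "A j powr\<^sub>M p \<in> pos_def" if "j \<in> {1..n}" for j by (rule powr_pos_def[OF A[OF that]])
  have H: "H \<in> pos_def" unfolding H_def by (rule powr_pos_def[OF X(1)])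
  have Z: "Z j \<in> pos_def" if "j \<in> {1..n}" for j
    unfolding Z_def by (rule pos_def_congruence_self[OF H Ap[OF that]])
  have "Re (cip v (X powr\<^sub>M p *v v)) \<le> Re (cip v ((\<Sum>j=1..n. w j *\<^sub>R A j powr\<^sub>M p) *v v))" for v
  proof -
    \<comment> \<open>Substituting v = H u carries out the congruence with the inverse of H at the
      level of quadratic forms.\<close>
    define u where "u = X powr\<^sub>M (- (\<alpha> / (2 * z))) *v v"
    have Hu: "H *v u = v"
      unfolding u_def H_def matrix_vector_mul_assoc pos_def_powr_inverse[OF X(1)] by simp
    have "- (\<alpha> / (2 * z)) + (1 / z + - (\<alpha> / (2 * z))) = p"
      using z by (simp add: p_def field_simps)
    hence "Re (cip v (X powr\<^sub>M p *v v)) = Re (cip u (X powr\<^sub>M (1 / z) *v u))"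
      by (simp add: u_def matrix_vector_mul_assoc pos_def_powr_add[OF X(1)] pos_def_cip_powr[OF X(1)])
    also have "\<dots> \<le> (\<Sum>j=1..n. w j * Re (cip u ((Z j powr\<^sub>M z) powr\<^sub>M (1 / z) *v u)))"
      using z by (intro powr_convex[OF powr_pos_def[OF Z] w0 w1 X]) (auto simp: field_simps)
    also have "\<dots> = (\<Sum>j=1..n. w j * Re (cip v (A j powr\<^sub>M p *v v)))"
    proof (intro sum.cong refl)
      fix j assume j: "j \<in> {1..n}"
      have "(Z j powr\<^sub>M z) powr\<^sub>M (1 / z) = adj H ** A j powr\<^sub>M p ** H"
        using z by (simp add: pos_def_powr_powr pos_def_powr_1 Z[OF j]) (simp add: Z_def pos_def_adj[OF H])
      thus "w j * Re (cip u ((Z j powr\<^sub>M z) powr\<^sub>M (1 / z) *v u)) = w j * Re (cip v (A j powr\<^sub>M p *v v))"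
        by (simp only: cip_congruence Hu)
    qed
    finally show ?thesis by (simp only: Re_cip_combination)
  qed
  moreover have "hermitian ((\<Sum>j=1..n. w j *\<^sub>R A j powr\<^sub>M p) - X powr\<^sub>M p)"
    using Ap powr_pos_def[OF X(1)] by (simp add: hermitian_def adj_sum pos_def_adj)
  ultimately show ?thesis
    unfolding loewner_le_def psd_def quad_form_cip X_def[symmetric] p_def[symmetric]
    by (simp add: matrix_vector_mult_diff_rdistrib)
qed

section \<open>Hadamard products\<close>

text \<open>Only A is diagonalized. The form of the product at v is the sum over k of d k times the
  form of B at \<open>y k\<close>, the entrywise product of v with the conjugate of column k of
  U.\<close>

lemma psd_hadamard:
  fixes A B :: "complex^'m^'m"
  assumes A: "psd A" and B: "psd B"
  shows "psd (A \<circ>\<^sub>H B)"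
proof -
  have hA: "hermitian A" and hB: "hermitian B" using A B by (auto simp: psd_def)
  obtain U d where U: "unitary U" "A = spec U d"
    by (rule hermitian_spectral[OF hA]) (auto simp: spec_def)
  have d0: "0 \<le> d k" for k
    using A spec_column(1)[OF U(1), of k d] unfolding psd_def quad_form_cip U(2) by metis
  have Aij: "A $ i $ j = (\<Sum>k\<in>UNIV. U $ i $ k * of_real (d k) * cnj (U $ j $ k))" for i j
    unfolding U(2) spec_def by (simp add: matrix_matrix_mult_def[of "U ** real_diag d"] mult_real_diag adj_def)
  have "0 \<le> Re (cip v ((A \<circ>\<^sub>H B) *v v))" for v
  proof -
    define y where "y k = (\<chi> i. v $ i * cnj (U $ i $ k))" for k
    have "cip v ((A \<circ>\<^sub>H B) *v v) =
        (\<Sum>i\<in>UNIV. \<Sum>j\<in>UNIV. \<Sum>k\<in>UNIV. of_real (d k) * (cnj (y k $ i) * (B $ i $ j * y k $ j)))"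
      by (simp add: cip_def matrix_vector_mult_def hadamard_def Aij y_def sum_distrib_left sum_distrib_right mult_ac)
    also have "\<dots> = (\<Sum>i\<in>UNIV. \<Sum>k\<in>UNIV. \<Sum>j\<in>UNIV. of_real (d k) * (cnj (y k $ i) * (B $ i $ j * y k $ j)))"
      by (intro sum.cong refl sum.swap)
    also have "\<dots> = (\<Sum>k\<in>UNIV. \<Sum>i\<in>UNIV. \<Sum>j\<in>UNIV. of_real (d k) * (cnj (y k $ i) * (B $ i $ j * y k $ j)))"
      by (rule sum.swap)
    also have "\<dots> = (\<Sum>k\<in>UNIV. of_real (d k) * cip (y k) (B *v y k))"
      by (simp add: cip_def matrix_vector_mult_def sum_distrib_left)
    finally have "Re (cip v ((A \<circ>\<^sub>H B) *v v)) = (\<Sum>k\<in>UNIV. d k * Re (cip (y k) (B *v y k)))"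
      by simp
    thus ?thesis using B d0 by (auto simp: psd_def quad_form_cip intro!: sum_nonneg)
  qed
  moreover have "hermitian (A \<circ>\<^sub>H B)"
    using hA hB by (simp add: hermitian_def adj_def hadamard_def vec_eq_iff)
  ultimately show ?thesis by (simp add: psd_def quad_form_cip)
qed

lemma psd_add: "psd A \<Longrightarrow> psd B \<Longrightarrow> psd (A + B)"
  by (simp add: psd_def hermitian_def quad_form_cip matrix_vector_mult_add_rdistrib)

lemma pos_def_psd: "A \<in> pos_def \<Longrightarrow> psd A"
  unfolding pos_def_def psd_def quad_form_cip
  by (metis (mono_tags, lifting) cip_simps(1) less_imp_le mem_Collect_eq order_refl zero_complex.sel(1))

text \<open>The difference splits as (M - P) \<circ> N + P \<circ> (N - Q), which explains why
  positivity is asked of one lower and one upper factor.\<close>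

lemma hadamard_mono:
  assumes "psd P" "psd N" "P \<preceq>\<^sub>L M" "Q \<preceq>\<^sub>L N"
  shows "P \<circ>\<^sub>H Q \<preceq>\<^sub>L M \<circ>\<^sub>H N"
proof -
  have "M \<circ>\<^sub>H N - P \<circ>\<^sub>H Q = (M - P) \<circ>\<^sub>H N + P \<circ>\<^sub>H (N - Q)"
    by (simp add: hadamard_def vec_eq_iff algebra_simps)
  thus ?thesis
    using assms by (simp add: loewner_le_def psd_add psd_hadamard)
qed

lemma psd_combination:
  assumes "\<And>j. j \<in> J \<Longrightarrow> psd (W j)" "\<And>j. j \<in> J \<Longrightarrow> 0 \<le> w j"
  shows "psd (\<Sum>j\<in>J. w j *\<^sub>R W j)"
  using assms unfolding psd_def quad_form_cip Re_cip_combination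
  by (auto simp: hermitian_def adj_sum intro!: sum_nonneg)

theorem theorem5p3:
  fixes A B :: "nat \<Rightarrow> complex^'m^'m"
    and n :: nat
    and w \<mu> :: "nat \<Rightarrow> real"
    and \<alpha> z :: real
  assumes "n \<ge> 1"
    and "\<And>j. j \<in> {1..n} \<Longrightarrow> A j \<in> pos_def"
    and "\<And>j. j \<in> {1..n} \<Longrightarrow> B j \<in> pos_def"
    and "w \<in> pos_prob_vecs n"
    and "\<mu> \<in> pos_prob_vecs n"
    and "0 < \<alpha>" "\<alpha> \<le> z" "z < 1" "1 / 2 \<le> z"
  shows "right_mean \<alpha> z n w A powr\<^sub>M ((1 - \<alpha>) / z) \<circ>\<^sub>H right_mean \<alpha> z n \<mu> B powr\<^sub>M ((1 - \<alpha>) / z)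
         \<preceq>\<^sub>L (\<Sum>i=1..n. \<Sum>j=1..n.
               (w i * \<mu> j) *\<^sub>R (A i powr\<^sub>M ((1 - \<alpha>) / z) \<circ>\<^sub>H B j powr\<^sub>M ((1 - \<alpha>) / z)))"
proof -
  define p where "p = (1 - \<alpha>) / z"
  \<comment> \<open>The double sum is M \<circ> N by bilinearity, so the claim reduces to one
    inequality for each family.\<close>
  define M N where "M = (\<Sum>i=1..n. w i *\<^sub>R A i powr\<^sub>M p)" and "N = (\<Sum>j=1..n. \<mu> j *\<^sub>R B j powr\<^sub>M p)"
  have "psd N"
    unfolding N_def using assms(5)
    by (intro psd_combination pos_def_psd powr_pos_def assms(3)) (auto simp: pos_prob_vecs_def less_imp_le)
  moreover have "psd (right_mean \<alpha> z n w A powr\<^sub>M p)"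
    using assms by (intro pos_def_psd powr_pos_def right_mean_fixed_point(1)) auto
  moreover have "right_mean \<alpha> z n w A powr\<^sub>M p \<preceq>\<^sub>L M" "right_mean \<alpha> z n \<mu> B powr\<^sub>M p \<preceq>\<^sub>L N"
    unfolding M_def N_def p_def by (intro right_mean_powr_le assms; assumption)+
  ultimately have "right_mean \<alpha> z n w A powr\<^sub>M p \<circ>\<^sub>H right_mean \<alpha> z n \<mu> B powr\<^sub>M p \<preceq>\<^sub>L M \<circ>\<^sub>H N"
    by (intro hadamard_mono)
  moreover have "M \<circ>\<^sub>H N = (\<Sum>i=1..n. \<Sum>j=1..n. (w i * \<mu> j) *\<^sub>R (A i powr\<^sub>M p \<circ>\<^sub>H B j powr\<^sub>M p))"
    by (simp add: M_def N_def vec_eq_iff hadamard_def sum_product mult.commute[of "w _"])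
  ultimately show ?thesis by (simp add: p_def)
qed

end
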